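(* In the limit as $k\to\infty$ (over positive integers $k$), we have $$f(\mathbb{N}_k)=\sum_{\Omega(n)=k}\frac{1}{n\log n}\ \sim\ 1\qquad\text{and}\qquad f(\mathbb{N}^*_k)=\sum_{\Omega(n)=k}\frac{\mu(n)^2}{n\log n}\ \sim\ \frac{6}{\pi^2}.$$
   Context: For a positive integer $n$, $\Omega(n)$ denotes the number of prime factors of $n$ counted with multiplicity, and $\mu$ is the M\"obius function. For each integer $k\ge 1$, $\mathbb{N}_k=\{n\ge 1:\Omega(n)=k\}$ is the set of $k$-almost primes, and $\mathbb{N}^*_k$ is the set of squarefree members of $\mathbb{N}_k$. For a set $A$ of integers $>1$, $f(A):=\sum_{n\in A}\frac{1}{n\log n}$. *)

theory Defs
  imports
    "HOL-Analysis.Analysis"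
    "HOL-Library.Landau_Symbols"
    "HOL-Computational_Algebra.Primes"
    "HOL-Computational_Algebra.Squarefree"
begin

definition big_omega :: "nat \<Rightarrow> nat" where
  "big_omega n = size (prime_factorization n)"

definition moebius_mu :: "nat \<Rightarrow> int" where
  "moebius_mu n = (if squarefree n then (-1) ^ card (prime_factors n) else 0)"

definition almost_primes :: "nat \<Rightarrow> nat set" where
  "almost_primes k = {n. n \<ge> 1 \<and> big_omega n = k}"

definition squarefree_almost_primes :: "nat \<Rightarrow> nat set" where
  "squarefree_almost_primes k = {n \<in> almost_primes k. squarefree n}"

(* Meant for sets A of integers > 1. An infinite sum that does not converge has the value 0
   here, so the sum being asymptotic to a nonzero constant includes its convergence for all
   large k. *)
definition erdos_sum :: "nat set \<Rightarrow> real" where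
  "erdos_sum A = (\<Sum>\<^sub>\<infinity>n\<in>A. 1 / (real n * ln (real n)))"

end

theory Submission
  imports Defs
begin

text \<open>
  Write \<open>P s\<close> for the prime zeta function and \<open>w n = (\<Prod>p | n. 1 / fact (multiplicity p n))\<close>, so that
  by the multinomial theorem the part of \<open>\<Sum>n. w n / n powr s\<close> with \<open>\<Omega> n = k\<close> is \<open>P s ^ k / fact k\<close>, and the
  whole series is \<open>exp (P s)\<close>. Integrating over \<open>s > 1\<close> replaces \<open>1 / n powr s\<close> by \<open>1 / (n * ln n)\<close>. As
  \<open>P (1 + u) = C - ln u + o(1)\<close> for \<open>u \<rightarrow> 0\<close>, and \<open>(C - ln u) ^ k / fact k\<close> is the derivative of
  \<open>u * (\<Sum>i\<le>k. (C - ln u) ^ i / fact i)\<close>, the Erdos sum over \<open>\<Omega> n = k\<close> weighted by \<open>w\<close> tends to \<open>exp C\<close>.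

  The constant function 1 and the indicator of the squarefree numbers are Dirichlet convolutions
  of \<open>w\<close> with multiplicative functions \<open>G\<close> supported on powerful numbers, for which \<open>\<Sum>d. G d / d\<close>
  converges absolutely. By dominated convergence their Erdos sums tend to \<open>exp C * (\<Sum>d. G d / d)\<close>. The
  Dirichlet series \<open>\<zeta> s\<close> and \<open>\<zeta> s / \<zeta> (2 * s)\<close> factor in the same way as \<open>(\<Sum>d. G d / d powr s) * exp (P s)\<close>,
  so comparing them as \<open>s \<rightarrow> 1\<close> identifies the two limits as 1 and \<open>1 / \<zeta> 2\<close>.
\<close>

section \<open>Multiplicative functions and Dirichlet convolution\<close>

text \<open>A multiplicative function whose value at a prime power depends only on the exponent is
  given by one real sequence. For sequences starting with 1, Dirichlet convolution then becomes the
  Cauchy product of the sequences.\<close>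

definition mult_ext :: "(nat \<Rightarrow> real) \<Rightarrow> nat \<Rightarrow> real" where
  "mult_ext c n = (\<Prod>p\<in>prime_factors n. c (multiplicity p n))"

text \<open>Primes not dividing \<open>n\<close> contribute \<open>c 0 = 1\<close>. This lets a
  number and its divisors share one index set.\<close>

lemma mult_ext_superset:
  assumes "finite S" "\<And>p. p \<in> S \<Longrightarrow> prime p" "prime_factors n \<subseteq> S" "n > 0" "c 0 = 1"
  shows "mult_ext c n = (\<Prod>p\<in>S. c (multiplicity p n))"
  unfolding mult_ext_def
proof (rule prod.mono_neutral_left)
  show "\<forall>p\<in>S - prime_factors n. c (multiplicity p n) = 1"
    using assms by (auto simp: prime_factors_dvd not_dvd_imp_multiplicity_0)
qed (use assms in auto)

text \<open>Expanding the product over the primes of \<open>n\<close> picks an exponent of at most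
  \<open>multiplicity p n\<close> for each prime \<open>p\<close>, and such a choice is the same
  thing as a divisor of \<open>n\<close>.\<close>

lemma mult_ext_convolution:
  fixes n :: nat
  assumes n: "n > 0" and ab: "a 0 = 1" "b 0 = 1"
  shows "(\<Sum>d | d dvd n. mult_ext a d * mult_ext b (n div d)) =
           mult_ext (\<lambda>k. \<Sum>i\<le>k. a i * b (k - i)) n"
proof -
  define S where "S = prime_factors n"
  define v where "v = (\<lambda>p. multiplicity p n)"
  have S: "finite S" "\<And>p. p \<in> S \<Longrightarrow> prime p" by (auto simp: S_def)
  have sub: "prime_factors d \<subseteq> S" if "d dvd n" for d
    using that n by (simp add: S_def dvd_prime_factors)
  have recon: "(\<Prod>p\<in>S. p ^ multiplicity p d) = d" if d: "d dvd n" for d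
  proof -
    have "d > 0" using d n by (auto intro: Nat.gr0I)
    have "(\<Prod>p\<in>S. p ^ multiplicity p d) = (\<Prod>p\<in>prime_factors d. p ^ multiplicity p d)"
      by (rule prod.mono_neutral_right)
         (use S sub[OF d] \<open>d > 0\<close> in \<open>auto simp: prime_factors_dvd not_dvd_imp_multiplicity_0\<close>)
    also have "\<dots> = d" using \<open>d > 0\<close> prod_prime_factors[of d] by simp
    finally show ?thesis .
  qed
  have mult: "multiplicity p (\<Prod>q\<in>S. q ^ h q) = h p" if "p \<in> S" for p h
    using that S by (subst multiplicity_prod_prime_powers) auto
  have "mult_ext (\<lambda>k. \<Sum>i\<le>k. a i * b (k - i)) n = (\<Prod>p\<in>S. \<Sum>i\<in>{..v p}. a i * b (v p - i))"
    by (simp add: mult_ext_def S_def v_def)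
  also have "\<dots> = (\<Sum>h\<in>PiE S (\<lambda>p. {..v p}). \<Prod>p\<in>S. a (h p) * b (v p - h p))"
    by (rule prod_sum_PiE) (use S in auto)
  also have "\<dots> = (\<Sum>d | d dvd n. mult_ext a d * mult_ext b (n div d))"
  proof (rule sum.reindex_bij_witness[where i = "\<lambda>d. restrict (\<lambda>p. multiplicity p d) S"
                                       and j = "\<lambda>h. \<Prod>p\<in>S. p ^ h p"])
    fix h assume h: "h \<in> PiE S (\<lambda>p. {..v p})"
    show "restrict (\<lambda>p. multiplicity p (\<Prod>p\<in>S. p ^ h p)) S = h"
      using h by (intro ext) (auto simp: restrict_def mult PiE_def extensional_def)
    define d where "d = (\<Prod>p\<in>S. p ^ h p)"
    have d0: "d > 0" unfolding d_def using S by (auto intro!: prod_pos simp: prime_gt_0_nat)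
    have "d dvd (\<Prod>p\<in>S. p ^ v p)" unfolding d_def
      by (rule prod_dvd_prod) (use h in \<open>auto intro!: le_imp_power_dvd\<close>)
    then have d: "d dvd n" using recon[of n] by (simp add: v_def)
    then show "(\<Prod>p\<in>S. p ^ h p) \<in> {d. d dvd n}" by (simp add: d_def)
    obtain m where m: "n = d * m" using d by blast
    have m0: "m > 0" "n div d = m" using m n d0 by auto
    have vm: "multiplicity p m = v p - h p" if "p \<in> S" for p
    proof -
      have "v p = multiplicity p d + multiplicity p m"
        unfolding v_def m using that S d0 m0
        by (subst prime_elem_multiplicity_mult_distrib) auto
      then show ?thesis using mult[OF that] by (simp add: d_def)
    qed
    have "mult_ext a d * mult_ext b m = (\<Prod>p\<in>S. a (h p)) * (\<Prod>p\<in>S. b (v p - h p))"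
      using S sub[of d] sub[of m] d m d0 m0 ab vm mult
      by (subst (1 2) mult_ext_superset[of S]) (auto simp: d_def)
    then show "mult_ext a (\<Prod>p\<in>S. p ^ h p) * mult_ext b (n div (\<Prod>p\<in>S. p ^ h p)) =
      (\<Prod>p\<in>S. a (h p) * b (v p - h p))"
      using m0 by (simp add: d_def prod.distrib)
  next
    fix d assume d: "d \<in> {d. d dvd n}"
    then show "(\<Prod>p\<in>S. p ^ restrict (\<lambda>p. multiplicity p d) S p) = d"
      using recon[of d] by simp
    show "restrict (\<lambda>p. multiplicity p d) S \<in> PiE S (\<lambda>p. {..v p})"
      using d n by (auto simp: v_def dvd_imp_multiplicity_le)
  qed
  finally show ?thesis ..
qed

lemma mult_ext_nonneg: "(\<And>k. c k \<ge> 0) \<Longrightarrow> mult_ext c n \<ge> 0"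
  unfolding mult_ext_def by (rule prod_nonneg) auto

lemma mult_ext_abs_le_1: "(\<And>k. \<bar>c k\<bar> \<le> 1) \<Longrightarrow> \<bar>mult_ext c n\<bar> \<le> 1"
  unfolding mult_ext_def abs_prod by (rule prod_le_1) auto

lemma mult_ext_const_1 [simp]: "mult_ext (\<lambda>_. 1) n = 1"
  by (simp add: mult_ext_def)

definition squarefree_coeff :: "nat \<Rightarrow> real" where
  "squarefree_coeff k = (if k \<le> 1 then 1 else 0)"

lemma mult_ext_squarefree:
  assumes "n > 0"
  shows "mult_ext squarefree_coeff n = (if squarefree n then 1 else 0)"
proof (cases "squarefree n")
  case True
  have "multiplicity p n \<le> 1" if "p \<in> prime_factors n" for p
    using True that assms by (auto simp: squarefree_factorial_semiring'')
  then show ?thesis using True by (auto simp: mult_ext_def squarefree_coeff_def intro!: prod.neutral)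
next
  case False
  then obtain p where "prime p" "multiplicity p n > 1"
    using assms by (auto simp: squarefree_factorial_semiring'' not_le)
  moreover from this have "p \<in> prime_factors n"
    using assms by (auto simp: prime_factors_multiplicity)
  ultimately show ?thesis using False unfolding mult_ext_def squarefree_coeff_def
    by (auto intro!: bexI[of _ p])
qed

text \<open>As \<open>c 1 = 0\<close>, no prime divides \<open>n\<close> exactly once. Write
  \<open>n = s * t ^ 2\<close> with \<open>s\<close> squarefree: a prime of \<open>s\<close> has odd
  exponent in \<open>n\<close>, hence exponent at least 3, so it divides \<open>t\<close>. Thus
  \<open>s\<close> divides \<open>t\<close>, and \<open>u\<close> is the cofactor.\<close>

lemma powerful_decompose:
  assumes "n > 0" "c 1 = 0" "mult_ext c n \<noteq> (0::real)"
  obtains s u where "s > 0" "u > 0" "n = s ^ 3 * u ^ 2"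
proof -
  define s t where "s = squarefree_part n" and "t = square_part n"
  have n: "n = s * t ^ 2" unfolding s_def t_def by (rule squarefree_decompose)
  have st: "s > 0" "t > 0" using n assms(1) by (auto intro: Nat.gr0I)
  have "s dvd t"
  proof (rule multiplicity_le_imp_dvd)
    fix p :: nat assume p: "prime p"
    have ms: "multiplicity p s = multiplicity p n mod 2"
      using p assms(1) by (simp add: s_def prime_multiplicity_squarefree_part)
    have mt: "multiplicity p t = multiplicity p n div 2"
      using p by (simp add: t_def prime_multiplicity_square_part)
    have "multiplicity p n \<noteq> 1"
    proof
      assume "multiplicity p n = 1"
      moreover from this p assms(1) have "p \<in> prime_factors n"
        by (auto simp: prime_factors_multiplicity)
      ultimately have "mult_ext c n = 0" unfolding mult_ext_def using assms(2)
        by (auto intro!: bexI[of _ p])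
      with assms(3) show False by simp
    qed
    then show "multiplicity p s \<le> multiplicity p t" unfolding ms mt by presburger
  qed (use st in auto)
  then obtain u where "t = s * u" by blast
  with n st show ?thesis by (intro that[of s u]) (auto simp: power_mult_distrib power2_eq_square power3_eq_cube)
qed

text \<open>The support consists of numbers \<open>s ^ 3 * u ^ 2\<close>, and the product of the
  series of \<open>1 / s ^ 3\<close> and \<open>1 / u ^ 2\<close> converges. Choosing one pair for
  each \<open>n\<close> embeds the support into the pairs.\<close>

lemma mult_ext_summable:
  assumes "c 1 = 0" "\<And>k. \<bar>c k\<bar> \<le> 1"
  shows "(\<lambda>n. \<bar>mult_ext c n\<bar> / real n) summable_on {0<..}"
proof -
  let ?A = "{n. n > 0 \<and> mult_ext c n \<noteq> 0}"
  let ?f = "\<lambda>(s,u). s ^ 3 * u ^ 2 :: nat"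
  have "\<exists>x. fst x > 0 \<and> snd x > 0 \<and> ?f x = n" if n: "n \<in> ?A" for n
  proof -
    obtain s u where "s > 0" "u > 0" "n = s ^ 3 * u ^ 2"
      using powerful_decompose[of n c] n assms(1) by auto
    then show ?thesis by (intro exI[of _ "(s, u)"]) simp
  qed
  then have "\<exists>i. \<forall>n\<in>?A. fst (i n) > 0 \<and> snd (i n) > 0 \<and> ?f (i n) = n"
    by (intro bchoice ballI) auto
  then obtain i where i: "\<And>n. n \<in> ?A \<Longrightarrow> fst (i n) > 0 \<and> snd (i n) > 0 \<and> ?f (i n) = n"
    by blast
  have "(\<lambda>n::nat. 1 / real n ^ k) summable_on UNIV" if "k \<ge> 2" for k
    by (rule summable_nonneg_imp_summable_on) (use inverse_power_summable[of k, where 'a=real] that in \<open>auto simp: inverse_eq_divide power_divide\<close>)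
  note inv_pow = this
  obtain C where C: "((\<lambda>u::nat. 1 / real u ^ 2) has_sum C) UNIV"
    using inv_pow[of 2] by (auto simp: summable_on_def)
  \<comment> \<open>Pairs with a zero entry contribute 0, since division by 0 gives 0, so the sum
    may run over all pairs.\<close>
  have "(\<lambda>x. 1 / real (?f x)) summable_on (SIGMA s:UNIV. UNIV)"
  proof (rule summable_on_SigmaI)
    fix s :: nat
    show "((\<lambda>u. 1 / real (?f (s, u))) has_sum (1 / real s ^ 3) * C) UNIV"
      using has_sum_cmult_right[OF C, of "1 / real s ^ 3"] by simp
    show "(\<lambda>s::nat. (1 / real s ^ 3) * C) summable_on UNIV"
      by (rule summable_on_cmult_left) (rule inv_pow, simp)
  qed auto
  then have "(\<lambda>x. 1 / real (?f x)) summable_on (i ` ?A)"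
    by (rule summable_on_subset) auto
  moreover have "inj_on i ?A" by (rule inj_on_inverseI[where g = ?f]) (use i in blast)
  ultimately have "(\<lambda>n. 1 / real (?f (i n))) summable_on ?A"
    by (subst (asm) summable_on_reindex) (auto simp: o_def)
  then have "(\<lambda>n. \<bar>mult_ext c n\<bar> / real n) summable_on ?A"
    by (rule summable_on_comparison_test)
       (use mult_ext_abs_le_1[of c] assms(2) i in \<open>auto intro!: divide_right_mono\<close>)
  then show ?thesis
    by (rule summable_on_cong_neutral[THEN iffD1, rotated -1]) auto
qed

text \<open>The double series over pairs \<open>(d, m)\<close> converges absolutely and may be
  regrouped by the product \<open>n = d * m\<close>. The factor \<open>\<phi>\<close> stays general
  because it serves both for \<open>n powr -s\<close> and for the Erdos weight cut off to one value
  of \<Omega>.\<close>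

lemma dirichlet_has_sum:
  fixes g w \<phi> W :: "nat \<Rightarrow> real"
  assumes nn: "\<And>m. w m \<ge> 0" "\<And>n. \<phi> n \<ge> 0"
    and W: "\<And>d. d > 0 \<Longrightarrow> ((\<lambda>m. w m * \<phi> (d * m)) has_sum W d) {0<..}"
    and sm: "(\<lambda>d. \<bar>g d\<bar> * W d) summable_on {0<..}"
  shows "((\<lambda>n. (\<Sum>d | d dvd n. g d * w (n div d)) * \<phi> n) has_sum (\<Sum>\<^sub>\<infinity>d\<in>{0<..}. g d * W d)) {0<..}"
proof -
  define A :: "nat set" where "A = {0<..}"
  define F where "F = (\<lambda>(d,m). g d * (w m * \<phi> (d * m)))"
  have "(\<lambda>x. \<bar>F x\<bar>) summable_on (SIGMA d:A. A)"
  proof (rule summable_on_SigmaI)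
    fix d assume "d \<in> A"
    then have "((\<lambda>m. \<bar>g d\<bar> * (w m * \<phi> (d * m))) has_sum \<bar>g d\<bar> * W d) A"
      unfolding A_def by (intro has_sum_cmult_right W) simp
    then show "((\<lambda>m. \<bar>F (d, m)\<bar>) has_sum \<bar>g d\<bar> * W d) A"
      by (simp add: F_def abs_mult nn)
  qed (use sm in \<open>auto simp: A_def\<close>)
  then have "F summable_on (SIGMA d:A. A)"
    by (subst summable_on_iff_abs_summable_on_real) simp
  then obtain S where S: "(F has_sum S) (SIGMA d:A. A)" by (auto simp: summable_on_def)
  have "((\<lambda>d. g d * W d) has_sum S) A"
  proof (rule has_sum_SigmaD[OF S])
    fix d assume "d \<in> A"
    then show "((\<lambda>m. F (d, m)) has_sum g d * W d) A"
      unfolding A_def F_def prod.case by (intro has_sum_cmult_right W) simp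
  qed
  then have S_eq: "S = (\<Sum>\<^sub>\<infinity>d\<in>A. g d * W d)" by (simp add: infsumI)
  have "((\<lambda>(n,d). g d * w (n div d) * \<phi> n) has_sum S) (SIGMA n:A. {d. d dvd n})"
    using S by (rule has_sum_reindex_bij_witness[where i = "\<lambda>(n,d). (d, n div d)" and j = "\<lambda>(d,m). (d * m, d)", THEN iffD1, rotated -1])
      (auto simp: A_def F_def intro: Nat.gr0I)
  then have "((\<lambda>n. \<Sum>d | d dvd n. g d * w (n div d) * \<phi> n) has_sum S) A"
    by (rule has_sum_SigmaD) (auto simp: A_def intro!: has_sum_finite)
  then show ?thesis by (simp add: S_eq A_def sum_distrib_right)
qed

section \<open>The prime zeta function and almost primes\<close>

lemma big_omega_mult: "m > 0 \<Longrightarrow> n > 0 \<Longrightarrow> big_omega (m * n) = big_omega m + big_omega n"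
  by (simp add: big_omega_def prime_factorization_mult)

lemma big_omega_prime: "prime p \<Longrightarrow> big_omega p = 1"
  by (simp add: big_omega_def prime_factorization_prime)

lemma big_omega_eq_sum: "big_omega n = (\<Sum>p\<in>prime_factors n. multiplicity p n)"
  unfolding big_omega_def size_multiset_overloaded_eq
  by (intro sum.cong) (auto simp: count_prime_factorization in_prime_factors_iff)

lemma big_omega_1 [simp]: "big_omega (Suc 0) = 0"
  by (simp add: big_omega_def)

text \<open>Every prime factor is at least 2. The consequence needed later is that
  \<open>ln m\<close> tends to infinity uniformly on the numbers with \<Omega> equal to
  \<open>k\<close>, as \<open>k\<close> grows.\<close>

lemma two_power_big_omega_le: "n > 0 \<Longrightarrow> 2 ^ big_omega n \<le> n"
proof (induction n rule: prime_divisors_induct)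
  case (factor p n)
  then have "n > 0" "p \<ge> 2" by (auto simp: prime_ge_2_nat)
  then have "2 ^ big_omega (p * n) = 2 * 2 ^ big_omega n"
    using factor by (simp add: big_omega_mult big_omega_prime prime_gt_0_nat)
  also have "\<dots> \<le> p * n" using factor \<open>n > 0\<close> \<open>p \<ge> 2\<close> by (intro mult_mono) auto
  finally show ?case .
qed auto

lemma almost_primes_pos: "n \<in> almost_primes k \<Longrightarrow> n > 0"
  and almost_primes_big_omega: "n \<in> almost_primes k \<Longrightarrow> big_omega n = k"
  by (simp_all add: almost_primes_def)

lemma almost_primes_0: "almost_primes 0 = {1}"
proof -
  have "n = 1" if "n \<ge> 1" "big_omega n = 0" for n
    using that by (auto simp: big_omega_def prime_factorization_empty_iff)
  then show ?thesis by (auto simp: almost_primes_def)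
qed

lemma almost_primes_ge_2: "n \<in> almost_primes k \<Longrightarrow> k \<ge> 1 \<Longrightarrow> n \<ge> 2"
  using two_power_big_omega_le[of n] power_increasing[of 1 k "2::nat"]
  by (simp add: almost_primes_def)

lemma summable_on_powr:
  assumes "s > 1"
  shows "(\<lambda>n. real n powr -s) summable_on A"
proof -
  have "(\<lambda>n. real n powr -s) summable_on UNIV"
    by (rule summable_nonneg_imp_summable_on) (use assms in \<open>auto simp: summable_real_powr_iff\<close>)
  then show ?thesis by (rule summable_on_subset_banach) auto
qed

definition prime_zeta :: "real \<Rightarrow> real" where
  "prime_zeta s = (\<Sum>\<^sub>\<infinity>p | prime p. real p powr -s)"

lemma prime_zeta_has_sum: "s > 1 \<Longrightarrow> ((\<lambda>p. real p powr -s) has_sum prime_zeta s) {p. prime p}"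
  unfolding prime_zeta_def by (rule has_sum_infsum) (rule summable_on_powr)

lemma prime_zeta_nonneg: "prime_zeta s \<ge> 0"
  unfolding prime_zeta_def by (rule infsum_nonneg) simp

text \<open>Every prime is at least 2, so each term decays at least as fast as a power of 2. This
  makes powers of the prime zeta function integrable at infinity.\<close>

lemma prime_zeta_decay:
  assumes "1 < s" "s \<le> t"
  shows "prime_zeta t \<le> prime_zeta s * 2 powr -(t - s)"
proof (rule has_sum_mono)
  show "((\<lambda>p. real p powr -t) has_sum prime_zeta t) {p. prime p}"
    using assms by (intro prime_zeta_has_sum) auto
  show "((\<lambda>p. real p powr -s * 2 powr -(t - s)) has_sum prime_zeta s * 2 powr -(t - s)) {p. prime p}"
    using assms by (intro has_sum_cmult_left prime_zeta_has_sum) auto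
  fix p :: nat assume "p \<in> {p. prime p}"
  then have p: "real p \<ge> 2" by (auto dest: prime_ge_2_nat)
  have "real p powr -t = real p powr -s * real p powr -(t - s)"
    by (simp flip: powr_add)
  also have "\<dots> \<le> real p powr -s * 2 powr -(t - s)"
    using p assms by (intro mult_left_mono powr_mono2') auto
  finally show "real p powr -t \<le> real p powr -s * 2 powr -(t - s)" .
qed

section \<open>The factorial weight and powers of the prime zeta function\<close>

definition fact_weight :: "nat \<Rightarrow> real" where
  "fact_weight = mult_ext (\<lambda>k. 1 / fact k)"

lemma fact_weight_nonneg: "fact_weight n \<ge> 0"
  unfolding fact_weight_def by (rule mult_ext_nonneg) simp

lemma fact_weight_1 [simp]: "fact_weight (Suc 0) = 1"
  by (simp add: fact_weight_def mult_ext_def)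

text \<open>Passing from \<open>m\<close> to \<open>p * m\<close> raises the exponent of
  \<open>p\<close> from \<open>e\<close> to \<open>e + 1\<close>, which divides
  \<open>1 / fact e\<close> by \<open>e + 1\<close>; the other primes keep their exponents.\<close>

lemma fact_weight_prime_mult:
  assumes "prime p" "m > 0"
  shows "fact_weight m = real (multiplicity p (p * m)) * fact_weight (p * m)"
proof -
  define S where "S = insert p (prime_factors m)"
  have S: "finite S" "p \<in> S" "\<And>q. q \<in> S \<Longrightarrow> prime q" "prime_factors m \<subseteq> S" "prime_factors (p * m) \<subseteq> S"
    using assms by (auto simp: S_def prime_factorization_mult prime_factorization_prime prime_gt_0_nat)
  define f where "f = (\<lambda>(n::nat) (q::nat). 1 / fact (multiplicity q n) :: real)"
  have eq: "fact_weight n = f n p * (\<Prod>q\<in>S - {p}. f n q)" if "n > 0" "prime_factors n \<subseteq> S" for n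
    unfolding fact_weight_def f_def using S that
    by (subst mult_ext_superset[of S]) (auto simp: prod.remove)
  have "(\<Prod>q\<in>S - {p}. f (p * m) q) = (\<Prod>q\<in>S - {p}. f m q)"
  proof (rule prod.cong)
    fix q assume q: "q \<in> S - {p}"
    then have "multiplicity q p = 0"
      using assms S by (intro not_dvd_imp_multiplicity_0) (auto simp: primes_dvd_imp_eq)
    then show "f (p * m) q = f m q" using q S assms unfolding f_def
      by (subst prime_elem_multiplicity_mult_distrib) (auto simp: prime_gt_0_nat)
  qed simp
  moreover have mp: "multiplicity p (p * m) = Suc (multiplicity p m)"
    using assms by (intro multiplicity_times_same) (auto simp: prime_gt_0_nat)
  then have "f m p = real (multiplicity p (p * m)) * f (p * m) p"
    unfolding f_def mp by simp
  ultimately show ?thesis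
    using eq[of m] eq[of "p * m"] S assms by (simp add: prime_gt_0_nat)
qed

text \<open>
  Induction step: multiplying by \<open>P s\<close> sums over pairs \<open>(p, m)\<close>; collecting \<open>n = p * m\<close> and using
  \<open>w (n / p) = multiplicity p n * w n\<close> gives the factor \<open>\<Sum>p. multiplicity p n = \<Omega> n = k + 1\<close>.
\<close>
lemma fact_weight_power_has_sum:
  assumes s: "s > 1"
  shows "((\<lambda>m. fact_weight m * real m powr -s) has_sum prime_zeta s ^ k / fact k) (almost_primes k)"
proof (induction k)
  case 0
  then show ?case by (auto simp: almost_primes_0 intro!: has_sum_finiteI)
next
  case (Suc k)
  define F where "F = (\<lambda>(p::nat,m::nat). real p powr -s * (fact_weight m * real m powr -s))"
  define S where "S = prime_zeta s * (prime_zeta s ^ k / fact k)"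
  have inner: "((\<lambda>m. F (p, m)) has_sum real p powr -s * (prime_zeta s ^ k / fact k)) (almost_primes k)" for p :: nat
    unfolding F_def prod.case by (intro has_sum_cmult_right Suc)
  have outer: "((\<lambda>p::nat. real p powr -s * (prime_zeta s ^ k / fact k)) has_sum S) {p. prime p}"
    unfolding S_def by (intro has_sum_cmult_left prime_zeta_has_sum s)
  have "F summable_on (SIGMA p:{p::nat. prime p}. almost_primes k)"
    by (rule summable_on_SigmaI[OF inner has_sum_imp_summable[OF outer]])
       (auto simp: F_def fact_weight_nonneg)
  with inner outer have "(F has_sum S) (SIGMA p:{p::nat. prime p}. almost_primes k)"
    by (rule has_sum_SigmaI)
  then have "((\<lambda>(n::nat,p::nat). real (multiplicity p n) * (fact_weight n * real n powr -s)) has_sum S)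
               (SIGMA n:almost_primes (Suc k). prime_factors n)"
  proof (rule has_sum_reindex_bij_witness[where i = "\<lambda>(n,p). (p, n div p)" and j = "\<lambda>(p,m). (p * m, p)",
      THEN iffD1, rotated -1])
    fix x assume x: "x \<in> (SIGMA p:{p::nat. prime p}. almost_primes k)"
    obtain p m where [simp]: "x = (p, m)" by (cases x)
    have p: "prime p" "p > 0" and m: "m \<in> almost_primes k" "m > 0"
      using x by (auto simp: prime_gt_0_nat almost_primes_pos)
    show "(case (case x of (p, m) \<Rightarrow> (p * m, p)) of (n, p) \<Rightarrow> (p, n div p)) = x"
      using p by simp
    show "(case x of (p, m) \<Rightarrow> (p * m, p)) \<in> (SIGMA n:almost_primes (Suc k). prime_factors n)"
      using p m by (auto simp: almost_primes_def big_omega_mult big_omega_prime prime_factors_dvd)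
    show "(case (case x of (p, m) \<Rightarrow> (p * m, p)) of (n, p) \<Rightarrow>
            real (multiplicity p n) * (fact_weight n * real n powr -s)) = F x"
      using fact_weight_prime_mult[OF p(1) m(2)] by (simp add: F_def powr_mult)
  next
    fix y assume y: "y \<in> (SIGMA n:almost_primes (Suc k). prime_factors n)"
    obtain n p where [simp]: "y = (n, p)" by (cases y)
    have p: "prime p" "p > 0" "p dvd n" and n: "n > 0" "big_omega n = Suc k"
      using y by (auto simp: prime_factors_dvd prime_gt_0_nat almost_primes_def)
    then obtain m where m: "n = p * m" "m > 0" by (auto elim!: dvdE)
    show "(case (case y of (n, p) \<Rightarrow> (p, n div p)) of (p, m) \<Rightarrow> (p * m, p)) = y"
      using p by simp
    show "(case y of (n, p) \<Rightarrow> (p, n div p)) \<in> (SIGMA p:{p::nat. prime p}. almost_primes k)"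
      using p m n by (auto simp: almost_primes_def big_omega_mult big_omega_prime)
  qed simp
  then have "((\<lambda>n. \<Sum>p\<in>prime_factors n. real (multiplicity p n) * (fact_weight n * real n powr -s)) has_sum S)
               (almost_primes (Suc k))"
    by (rule has_sum_SigmaD) (auto intro!: has_sum_finite)
  also have "?this \<longleftrightarrow> ((\<lambda>n. real (Suc k) * (fact_weight n * real n powr -s)) has_sum S) (almost_primes (Suc k))"
    by (rule has_sum_cong)
       (simp flip: sum_distrib_right of_nat_sum big_omega_eq_sum add: almost_primes_big_omega)
  also have "\<dots> \<longleftrightarrow> ((\<lambda>n. fact_weight n * real n powr -s) has_sum (S / real (Suc k))) (almost_primes (Suc k))"
    by (rule has_sum_cmult_right_iff) simp
  also have "S / real (Suc k) = prime_zeta s ^ Suc k / fact (Suc k)"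
    by (simp add: S_def field_simps)
  finally show ?case .
qed

text \<open>The positive integers are partitioned by the value of \<Omega>, and the sums over the
  classes are the terms of the exponential series.\<close>

lemma fact_weight_exp_has_sum:
  assumes s: "s > 1"
  shows "((\<lambda>m. fact_weight m * real m powr -s) has_sum exp (prime_zeta s)) {0<..}"
proof -
  let ?f = "\<lambda>m. fact_weight m * real m powr -s"
  have outer: "((\<lambda>k. prime_zeta s ^ k / fact k) has_sum exp (prime_zeta s)) UNIV"
    using exp_converges[of "prime_zeta s"]
    by (intro sums_nonneg_imp_has_sum) (auto simp: prime_zeta_nonneg divide_inverse mult.commute)
  have inner: "((\<lambda>m. ?f (snd (k, m))) has_sum prime_zeta s ^ k / fact k) (almost_primes k)" for k
    using fact_weight_power_has_sum[OF s] by simp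
  have "(\<lambda>x. ?f (snd x)) summable_on (SIGMA k:UNIV. almost_primes k)"
    by (rule summable_on_SigmaI[OF inner has_sum_imp_summable[OF outer]])
       (auto simp: fact_weight_nonneg)
  with inner outer have "((\<lambda>x. ?f (snd x)) has_sum exp (prime_zeta s)) (SIGMA k:UNIV. almost_primes k)"
    by (rule has_sum_SigmaI)
  then show ?thesis
    by (rule has_sum_reindex_bij_witness[where i = "\<lambda>m. (big_omega m, m)" and j = snd, THEN iffD1, rotated -1])
       (auto simp: almost_primes_def)
qed

section \<open>Integrals of powers\<close>

text \<open>Fundamental theorem of calculus with the antiderivative \<open>F k\<close>:
  differentiating its sum lowers each power by one and gives a factor \<open>-1 / u\<close>, so
  against the sum itself only the top term survives.\<close>

lemma log_power_nn_integral:
  fixes c \<delta> :: real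
  assumes \<delta>: "\<delta> > 0" "c - ln \<delta> \<ge> 0"
  shows "(\<integral>\<^sup>+u. ennreal (indicator {0<..\<delta>} u * ((c - ln u) ^ k / fact k)) \<partial>lborel) =
           ennreal (\<delta> * (\<Sum>i\<le>k. (c - ln \<delta>) ^ i / fact i))"
proof -
  define F where "F = (\<lambda>k u. u * (\<Sum>i\<le>k. (c - ln u) ^ i / fact i))"
  \<comment> \<open>The value 0 at the endpoint makes the closed interval used for the calculus
    agree with the half-open one of the statement.\<close>
  define f where "f = (\<lambda>u. if u \<le> 0 then 0 else (c - ln u) ^ k / fact k)"
  have deriv: "(F k has_real_derivative (c - ln u) ^ k / fact k) (at u)" if "u > 0" for u k
  proof -
    have "((\<lambda>u. \<Sum>i\<le>k. (c - ln u) ^ i / fact i) has_real_derivative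
            (\<Sum>i\<le>k. real i * (c - ln u) ^ (i - 1) * (- (1 / u)) / fact i)) (at u)"
      using that by (auto intro!: derivative_eq_intros sum.cong simp: divide_simps)
    moreover have "(\<Sum>i\<le>k. real i * (c - ln u) ^ (i - 1) * (- (1 / u)) / fact i) =
           - (1 / u) * (\<Sum>i<k. (c - ln u) ^ i / fact i)"
    proof -
      have "(\<Sum>i\<le>k. real i * (c - ln u) ^ (i - 1) * (- (1 / u)) / fact i) =
            (\<Sum>i<k. real (Suc i) * (c - ln u) ^ i * (- (1 / u)) / fact (Suc i))"
        by (subst sum.atMost_shift) simp
      also have "\<dots> = (\<Sum>i<k. - (1 / u) * ((c - ln u) ^ i / fact i))"
      proof (rule sum.cong)
        fix i
        have "real (Suc i) / fact (Suc i) = 1 / (fact i :: real)"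
          by (simp add: fact_Suc del: of_nat_Suc)
        then show "real (Suc i) * (c - ln u) ^ i * (- (1 / u)) / fact (Suc i) =
            - (1 / u) * ((c - ln u) ^ i / fact i)"
          by (metis (no_types, opaque_lifting) mult.commute mult.left_commute mult_1 times_divide_eq_right)
      qed simp
      finally show ?thesis by (simp only: sum_distrib_left)
    qed
    ultimately have "((\<lambda>u. \<Sum>i\<le>k. (c - ln u) ^ i / fact i) has_real_derivative
            - (1 / u) * (\<Sum>i<k. (c - ln u) ^ i / fact i)) (at u)" by simp
    then have "(F k has_real_derivative 1 * (\<Sum>i\<le>k. (c - ln u) ^ i / fact i) +
       - (1 / u) * (\<Sum>i<k. (c - ln u) ^ i / fact i) * u) (at u)"
      unfolding F_def by (intro DERIV_mult DERIV_ident)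
    then show ?thesis using that
      by (simp add: lessThan_Suc_atMost[symmetric])
  qed
  have lim0: "(F k \<longlongrightarrow> 0) (at_right 0)"
  proof -
    \<comment> \<open>With \<open>x = c - ln u\<close> one has \<open>u = exp c / exp x\<close>, so
      \<open>u * x ^ i\<close> tends to 0 because the exponential beats every power.\<close>
    have *: "((\<lambda>u. (c - ln u) ^ i / exp (c - ln u)) \<longlongrightarrow> 0) (at_right 0)" for i
    proof (rule filterlim_compose[OF tendsto_power_div_exp_0])
      have "filterlim (\<lambda>u. - ln u) at_top (at_right (0::real))"
        using ln_at_0 by (simp only: filterlim_uminus_at_bot)
      from filterlim_tendsto_add_at_top[OF tendsto_const[of c] this]
      show "filterlim (\<lambda>u. c - ln u) at_top (at_right (0::real))" by simp
    qed
    have "((\<lambda>u. exp c * (\<Sum>i\<le>k. ((c - ln u) ^ i / exp (c - ln u)) / fact i)) \<longlongrightarrow> exp c * (\<Sum>i\<le>k. 0 / fact i)) (at_right 0)"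
      by (intro tendsto_intros *) auto
    moreover have "eventually (\<lambda>u. exp c * (\<Sum>i\<le>k. ((c - ln u) ^ i / exp (c - ln u)) / fact i) = F k u) (at_right 0)"
      using eventually_at_right_less[of 0]
      by eventually_elim (simp add: F_def sum_distrib_left exp_diff field_simps)
    ultimately show ?thesis by (simp add: tendsto_cong)
  qed
  have "continuous_on {0..\<delta>} (F k)"
    unfolding continuous_on_eq_continuous_within
  proof
    fix u assume u: "u \<in> {0..\<delta>}"
    show "continuous (at u within {0..\<delta>}) (F k)"
    proof (cases "u = 0")
      case True
      have "(F k \<longlongrightarrow> F k 0) (at 0 within {0..\<delta>})"
        using lim0 \<delta> by (simp add: F_def at_within_Icc_at_right)
      then show ?thesis using True by (simp add: continuous_within)
    next
      case False
      then show ?thesis using u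
        by (intro continuous_at_imp_continuous_at_within[OF DERIV_isCont[OF deriv]]) simp
    qed
  qed
  moreover have "(F k has_vector_derivative f u) (at u)" if "u \<in> {0<..<\<delta>}" for u
    using deriv[of u k] that
    by (simp add: f_def has_real_derivative_iff_has_vector_derivative)
  ultimately have "(f has_integral (F k \<delta> - F k 0)) {0..\<delta>}"
    using \<delta> by (intro fundamental_theorem_of_calculus_interior) auto
  then have "(f has_integral F k \<delta>) {0..\<delta>}" by (simp add: F_def)
  moreover have "f u \<ge> 0" if "u \<in> {0..\<delta>}" for u
  proof -
    have "c - ln u \<ge> 0" if "u > 0"
      using \<delta> ln_mono[of u \<delta>] that \<open>u \<in> {0..\<delta>}\<close> unfolding atLeastAtMost_iff by linarith
    then show ?thesis by (auto simp: f_def)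
  qed
  ultimately have "(\<integral>\<^sup>+u. ennreal (indicator {0..\<delta>} u * f u) \<partial>lborel) = ennreal (F k \<delta>)"
    by (intro nn_integral_has_integral_lebesgue)
  moreover have "indicator {0..\<delta>} u * f u = indicator {0<..\<delta>} u * ((c - ln u) ^ k / fact k)" for u
    by (auto simp: f_def indicator_def)
  ultimately show ?thesis by (simp add: F_def)
qed

text \<open>At \<open>a = 0\<close> this is the source of the logarithm in the Erdos sum; with
  \<open>b = 2\<close> and \<open>a = \<delta>\<close> it bounds the tail of the integral
  below.\<close>

lemma powr_nn_integral:
  fixes b a :: real
  assumes "b > 1"
  shows "(\<integral>\<^sup>+u. ennreal (indicator {a<..} u * b powr -u) \<partial>lborel) = ennreal (b powr -a / ln b)"
proof -
  have "(\<integral>\<^sup>+u. ennreal (b powr -u) * indicator {a..} u \<partial>lborel) = ennreal (0 - (- (b powr -a / ln b)))"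
  proof (rule nn_integral_FTC_atLeast)
    fix u
    show "((\<lambda>u. - (b powr -u / ln b)) has_real_derivative b powr -u) (at u)"
      using assms by (auto intro!: derivative_eq_intros)
    have "((\<lambda>u. exp (-(ln b * u))) \<longlongrightarrow> 0) at_top"
      using assms by (auto intro!: filterlim_compose[OF exp_at_bot] filterlim_tendsto_pos_mult_at_top[OF tendsto_const _ filterlim_ident]
         simp: filterlim_uminus_at_bot)
    then have "((\<lambda>u. - (exp (-(ln b * u)) / ln b)) \<longlongrightarrow> - (0 / ln b)) at_top"
      using assms by (intro tendsto_intros) auto
    then show "((\<lambda>u. - (b powr -u / ln b)) \<longlongrightarrow> 0) at_top"
      using assms by (simp add: powr_def mult.commute)
  qed auto
  moreover have "(\<integral>\<^sup>+u. ennreal (indicator {a<..} u * b powr -u) \<partial>lborel) =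
                 (\<integral>\<^sup>+u. ennreal (b powr -u) * indicator {a..} u \<partial>lborel)"
    by (rule nn_integral_cong_AE, rule AE_mp[OF AE_lborel_singleton[of a]])
       (auto simp: indicator_def)
  ultimately show ?thesis by simp
qed

text \<open>Near 0 the function \<open>Q\<close> lies between \<open>C - \<epsilon> - ln u\<close>
  and \<open>C + \<epsilon> - ln u\<close>, and the integrals of the k-th powers of these, over
  \<open>fact k\<close>, are partial exponential sums with limits
  \<open>exp (C - \<epsilon>)\<close> and \<open>exp (C + \<epsilon>)\<close>. Away from 0 the decay
  of \<open>Q\<close> leaves a contribution of order \<open>Q \<delta> ^ k / fact k\<close>, which
  vanishes in the limit.\<close>

lemma power_integral_tendsto:
  fixes Q :: "real \<Rightarrow> real" and C :: real
  assumes nonneg: "\<And>u. u > 0 \<Longrightarrow> Q u \<ge> 0"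
    and decay: "\<And>\<delta> u. 0 < \<delta> \<Longrightarrow> \<delta> \<le> u \<Longrightarrow> Q u \<le> Q \<delta> * 2 powr -(u - \<delta>)"
    and lim: "((\<lambda>u. Q u + ln u) \<longlongrightarrow> C) (at_right 0)"
  defines "J \<equiv> \<lambda>k. \<integral>\<^sup>+u. ennreal (indicator {0<..} u * (Q u ^ k / fact k)) \<partial>lborel"
  shows "k \<ge> 1 \<Longrightarrow> J k < \<infinity>" and "(\<lambda>k. enn2real (J k)) \<longlonglongrightarrow> exp C"
proof -
  have bounds: "\<exists>L U. (\<forall>k\<ge>1. ennreal (L k) \<le> J k \<and> J k \<le> ennreal (U k) \<and> 0 \<le> L k \<and> 0 \<le> U k) \<and>
                  L \<longlonglongrightarrow> exp (C - \<epsilon>) \<and> U \<longlonglongrightarrow> exp (C + \<epsilon>)" if \<epsilon>: "\<epsilon> > 0" for \<epsilon>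
  proof -
    have "eventually (\<lambda>u. dist (Q u + ln u) C < \<epsilon>) (at_right 0)"
      using lim \<epsilon> by (rule tendstoD)
    then obtain b where b: "b > 0" "\<And>u. 0 < u \<Longrightarrow> u < b \<Longrightarrow> dist (Q u + ln u) C < \<epsilon>"
      by (auto simp: eventually_at_right[of 0 1])
    \<comment> \<open>The first bound keeps \<open>u \<le> \<delta>\<close> inside the range where
      \<open>Q\<close> is known up to \<open>\<epsilon>\<close>; the second makes
      \<open>C - \<epsilon> - ln u\<close> nonnegative there, so that taking powers is
      monotone.\<close>
    define \<delta> where "\<delta> = min (b / 2) (exp (C - \<epsilon>))"
    have \<delta>: "\<delta> > 0" "\<delta> < b" using b by (auto simp: \<delta>_def)
    have "ln \<delta> \<le> ln (exp (C - \<epsilon>))" using \<delta> by (intro ln_mono) (auto simp: \<delta>_def)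
    then have ln\<delta>: "C - \<epsilon> - ln \<delta> \<ge> 0" "C + \<epsilon> - ln \<delta> \<ge> 0" using \<epsilon> by auto
    have near: "0 \<le> C - \<epsilon> - ln u" "C - \<epsilon> - ln u \<le> Q u" "Q u \<le> C + \<epsilon> - ln u" if u: "0 < u" "u \<le> \<delta>" for u
    proof -
      have "\<bar>Q u + ln u - C\<bar> < \<epsilon>" using b(2)[of u] u \<delta> by (simp add: dist_real_def)
      then show "C - \<epsilon> - ln u \<le> Q u" "Q u \<le> C + \<epsilon> - ln u" by linarith+
      have "ln u \<le> ln \<delta>" using u by (intro ln_mono) auto
      then show "0 \<le> C - \<epsilon> - ln u" using ln\<delta> by linarith
    qed
    \<comment> \<open>This is the integral over \<open>{0<..\<delta>}\<close>; the factor
      \<open>\<delta>\<close> cancels against \<open>exp (- ln \<delta>)\<close> in the limit, which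
      therefore does not depend on \<open>\<delta>\<close>.\<close>
    define E where "E = (\<lambda>c k. \<delta> * (\<Sum>i\<le>k. (c - ln \<delta>) ^ i / fact i))"
    have E_lim: "E c \<longlonglongrightarrow> exp c" for c
    proof -
      have "(\<lambda>k. \<Sum>i\<le>k. (c - ln \<delta>) ^ i / fact i) \<longlonglongrightarrow> exp (c - ln \<delta>)"
        using exp_converges[of "c - ln \<delta>"] by (simp add: sums_def_le divide_inverse mult.commute)
      then have "E c \<longlonglongrightarrow> \<delta> * exp (c - ln \<delta>)" unfolding E_def by (rule tendsto_mult_left)
      then show ?thesis using \<delta> by (simp add: exp_diff)
    qed
    have E_nonneg: "c - ln \<delta> \<ge> 0 \<Longrightarrow> E c k \<ge> 0" for c k
      unfolding E_def using \<delta> by (intro mult_nonneg_nonneg sum_nonneg) auto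
    \<comment> \<open>A bound for the integral over \<open>u > \<delta>\<close>.\<close>
    define R where "R = (\<lambda>k. Q \<delta> ^ k / fact k / ln 2)"
    have "(\<lambda>k. Q \<delta> ^ k / fact k) \<longlonglongrightarrow> 0"
      using summable_LIMSEQ_zero[OF summable_exp[of "Q \<delta>"]] by (simp add: field_simps)
    then have R_lim: "R \<longlonglongrightarrow> 0" unfolding R_def by (rule tendsto_divide_zero)
    have R_nonneg: "R k \<ge> 0" for k unfolding R_def using nonneg[OF \<delta>(1)] by simp
    have lower: "ennreal (E (C - \<epsilon>) k) \<le> J k" for k
    proof -
      have "ennreal (E (C - \<epsilon>) k) = (\<integral>\<^sup>+u. ennreal (indicator {0<..\<delta>} u * ((C - \<epsilon> - ln u) ^ k / fact k)) \<partial>lborel)"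
        unfolding E_def by (rule log_power_nn_integral[symmetric]) (use \<delta> ln\<delta> in auto)
      also have "\<dots> \<le> J k" unfolding J_def
        by (intro nn_integral_mono ennreal_leI)
           (auto simp: indicator_def intro!: divide_right_mono power_mono near divide_nonneg_nonneg zero_le_power nonneg)
      finally show ?thesis .
    qed
    have upper: "J k \<le> ennreal (E (C + \<epsilon>) k + R k)" if k: "k \<ge> 1" for k
    proof -
      define D where "D = Q \<delta> ^ k / fact k * 2 powr \<delta>"
      have D: "D \<ge> 0" using nonneg[OF \<delta>(1)] by (simp add: D_def)
      have far: "Q u ^ k / fact k \<le> D * 2 powr -u" if u: "u > \<delta>" for u
      proof -
        have le1: "2 powr -(u - \<delta>) \<le> 1" using powr_mono[of "-(u - \<delta>)" 0 2] u by simp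
        have "Q u ^ k \<le> (Q \<delta> * 2 powr -(u - \<delta>)) ^ k"
          using u \<delta> by (intro power_mono decay nonneg) auto
        also have "\<dots> = Q \<delta> ^ k * (2 powr -(u - \<delta>)) ^ k" by (simp add: power_mult_distrib)
        \<comment> \<open>As \<open>k \<ge> 1\<close>, one of the \<open>k\<close> decay factors can
          be kept for integrability and the others bounded by 1.\<close>
        also have "Q \<delta> ^ k * (2 powr -(u - \<delta>)) ^ k \<le> Q \<delta> ^ k * 2 powr -(u - \<delta>)"
          using le1 k nonneg[OF \<delta>(1)] power_decreasing[of 1 k "2 powr -(u - \<delta>)"]
          by (intro mult_left_mono) simp_all
        also have "2 powr -(u - \<delta>) = 2 powr \<delta> * 2 powr -u" by (simp flip: powr_add)
        finally show ?thesis unfolding D_def by (simp add: divide_right_mono field_simps)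
      qed
      have "J k \<le> (\<integral>\<^sup>+u. ennreal (indicator {0<..\<delta>} u * ((C + \<epsilon> - ln u) ^ k / fact k)) +
                         ennreal D * ennreal (indicator {\<delta><..} u * 2 powr -u) \<partial>lborel)"
        unfolding J_def
      proof (rule nn_integral_mono)
        fix u :: real
        consider "u \<le> 0" | "0 < u" "u \<le> \<delta>" | "u > \<delta>" by linarith
        then show "ennreal (indicator {0<..} u * (Q u ^ k / fact k)) \<le>
          ennreal (indicator {0<..\<delta>} u * ((C + \<epsilon> - ln u) ^ k / fact k)) + ennreal D * ennreal (indicator {\<delta><..} u * 2 powr -u)"
        proof cases
          case 1 then show ?thesis using \<delta> by simp
        next
          case 2
          then have "Q u ^ k / fact k \<le> (C + \<epsilon> - ln u) ^ k / fact k"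
            by (intro divide_right_mono power_mono near nonneg) auto
          then show ?thesis using 2 by (simp add: ennreal_leI)
        next
          case 3
          then show ?thesis using far[OF 3] \<delta> D by (simp add: ennreal_leI flip: ennreal_mult)
        qed
      qed
      also have "\<dots> = ennreal (E (C + \<epsilon>) k) + ennreal D * ennreal (2 powr -\<delta> / ln 2)"
        using log_power_nn_integral[of \<delta> "C + \<epsilon>" k] powr_nn_integral[of 2 \<delta>] \<delta> ln\<delta>
        by (subst nn_integral_add) (simp_all add: nn_integral_cmult E_def)
      also have "ennreal D * ennreal (2 powr -\<delta> / ln 2) = ennreal (R k)"
        using D by (simp add: D_def R_def powr_minus field_simps flip: ennreal_mult)
      also have "ennreal (E (C + \<epsilon>) k) + ennreal (R k) = ennreal (E (C + \<epsilon>) k + R k)"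
        using E_nonneg[OF ln\<delta>(2)] R_nonneg by simp
      finally show ?thesis .
    qed
    have "(\<lambda>k. E (C + \<epsilon>) k + R k) \<longlonglongrightarrow> exp (C + \<epsilon>) + 0"
      by (intro tendsto_add E_lim R_lim)
    with E_lim[of "C - \<epsilon>"] lower upper E_nonneg[OF ln\<delta>(1)] E_nonneg[OF ln\<delta>(2)] R_nonneg show ?thesis
      by (intro exI[of _ "E (C - \<epsilon>)"] exI[of _ "\<lambda>k. E (C + \<epsilon>) k + R k"]) auto
  qed
  show fin: "J k < \<infinity>" if "k \<ge> 1" for k
    \<comment> \<open>For finiteness any positive \<open>\<epsilon>\<close> would do.\<close>
    using bounds[of 1] that by (metis ennreal_less_top infinity_ennreal_def le_less_trans zero_less_one)
  have real_bounds: "\<exists>L U. (\<forall>k\<ge>1. L k \<le> enn2real (J k) \<and> enn2real (J k) \<le> U k) \<and>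
                  L \<longlonglongrightarrow> exp (C - \<epsilon>) \<and> U \<longlonglongrightarrow> exp (C + \<epsilon>)" if \<epsilon>: "\<epsilon> > 0" for \<epsilon>
  proof -
    obtain L U where LU: "\<And>k. k \<ge> 1 \<Longrightarrow> ennreal (L k) \<le> J k \<and> J k \<le> ennreal (U k) \<and> 0 \<le> L k \<and> 0 \<le> U k"
      "L \<longlonglongrightarrow> exp (C - \<epsilon>)" "U \<longlonglongrightarrow> exp (C + \<epsilon>)"
      using bounds[OF \<epsilon>] by blast
    have "L k \<le> enn2real (J k) \<and> enn2real (J k) \<le> U k" if "k \<ge> 1" for k
    proof -
      have "J k = ennreal (enn2real (J k))" using fin[OF that] by simp
      then show ?thesis using LU(1)[OF that]
        by (metis enn2real_nonneg ennreal_le_iff)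
    qed
    with LU(2,3) show ?thesis by blast
  qed
  show "(\<lambda>k. enn2real (J k)) \<longlonglongrightarrow> exp C"
  proof (rule order_tendstoI)
    fix a assume a: "a < exp C"
    have "((\<lambda>\<epsilon>. exp (C - \<epsilon>)) \<longlongrightarrow> exp (C - 0)) (at_right 0)" by (intro tendsto_intros)
    then have "eventually (\<lambda>\<epsilon>. exp (C - \<epsilon>) > a) (at_right 0)" using a by (intro order_tendstoD) auto
    then have "eventually (\<lambda>\<epsilon>. \<epsilon> > 0 \<and> exp (C - \<epsilon>) > a) (at_right 0)"
      by (intro eventually_conj eventually_at_right_less)
    then obtain \<epsilon> where \<epsilon>: "\<epsilon> > 0" "exp (C - \<epsilon>) > a"
      using eventually_happens'[OF trivial_limit_at_right_real] by blast
    obtain L U where LU: "\<forall>k\<ge>1. L k \<le> enn2real (J k) \<and> enn2real (J k) \<le> U k" "L \<longlonglongrightarrow> exp (C - \<epsilon>)"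
      using real_bounds[OF \<epsilon>(1)] by blast
    have "eventually (\<lambda>k. L k > a) sequentially" using LU(2) \<epsilon>(2) by (rule order_tendstoD)
    then show "eventually (\<lambda>k. enn2real (J k) > a) sequentially"
      using eventually_ge_at_top[of 1] by eventually_elim (use LU(1) in fastforce)
  next
    fix a assume a: "a > exp C"
    have "((\<lambda>\<epsilon>. exp (C + \<epsilon>)) \<longlongrightarrow> exp (C + 0)) (at_right 0)" by (intro tendsto_intros)
    then have "eventually (\<lambda>\<epsilon>. exp (C + \<epsilon>) < a) (at_right 0)" using a by (intro order_tendstoD) auto
    then have "eventually (\<lambda>\<epsilon>. \<epsilon> > 0 \<and> exp (C + \<epsilon>) < a) (at_right 0)"
      by (intro eventually_conj eventually_at_right_less)
    then obtain \<epsilon> where \<epsilon>: "\<epsilon> > 0" "exp (C + \<epsilon>) < a"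
      using eventually_happens'[OF trivial_limit_at_right_real] by blast
    obtain L U where LU: "\<forall>k\<ge>1. L k \<le> enn2real (J k) \<and> enn2real (J k) \<le> U k" "U \<longlonglongrightarrow> exp (C + \<epsilon>)"
      using real_bounds[OF \<epsilon>(1)] by blast
    have "eventually (\<lambda>k. U k < a) sequentially" using LU(2) \<epsilon>(2) by (rule order_tendstoD)
    then show "eventually (\<lambda>k. enn2real (J k) < a) sequentially"
      using eventually_ge_at_top[of 1] by eventually_elim (use LU(1) in fastforce)
  qed
qed

section \<open>From integrals of the prime zeta function to Erdos sums\<close>

lemma has_sum_imp_sums_indicator:
  fixes f :: "nat \<Rightarrow> real"
  assumes "(f has_sum S) A"
  shows "(\<lambda>n. indicator A n * f n) sums S"
  by (rule has_sum_imp_sums, rule has_sum_cong_neutral[THEN iffD1, OF _ _ _ assms]) auto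

text \<open>Integrating \<open>n powr -(1 + u)\<close> over \<open>u > 0\<close> gives
  \<open>1 / (n * ln n)\<close>. By Tonelli the weighted Erdos sum is the integral of
  \<open>prime_zeta (1 + u) ^ k / fact k\<close>, whose limit is known.\<close>

lemma fact_weight_erdos_sums:
  assumes lim: "((\<lambda>u. prime_zeta (1 + u) + ln u) \<longlongrightarrow> C) (at_right 0)"
  defines "T \<equiv> \<lambda>k. \<Sum>\<^sub>\<infinity>n\<in>almost_primes k. fact_weight n / (real n * ln (real n))"
  shows "k \<ge> 1 \<Longrightarrow> (\<lambda>n. fact_weight n / (real n * ln (real n))) summable_on almost_primes k"
    and "T \<longlonglongrightarrow> exp C"
proof -
  define J where "J = (\<lambda>k. \<integral>\<^sup>+u. ennreal (indicator {0<..} u * (prime_zeta (1 + u) ^ k / fact k)) \<partial>lborel)"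
  have decay: "0 < \<delta> \<Longrightarrow> \<delta> \<le> u \<Longrightarrow>
      prime_zeta (1 + u) \<le> prime_zeta (1 + \<delta>) * 2 powr -(u - \<delta>)" for u \<delta>
    using prime_zeta_decay[of "1 + \<delta>" "1 + u"] by simp
  have J1: "J k < \<infinity>" if "k \<ge> 1" for k
    unfolding J_def by (rule power_integral_tendsto(1)[OF _ _ lim that]) (rule prime_zeta_nonneg, rule decay)
  have J2: "(\<lambda>k. enn2real (J k)) \<longlonglongrightarrow> exp C"
    unfolding J_def by (rule power_integral_tendsto(2)[OF _ _ lim]) (rule prime_zeta_nonneg, rule decay)
  have T: "((\<lambda>n. fact_weight n / (real n * ln (real n))) has_sum enn2real (J k)) (almost_primes k)"
    if k: "k \<ge> 1" for k
  proof -
    define f where "f = (\<lambda>n. indicator (almost_primes k) n * (fact_weight n / (real n * ln (real n))))"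
    have f_nonneg: "f n \<ge> 0" for n
      by (cases "n > 0") (auto simp: f_def fact_weight_nonneg intro!: mult_nonneg_nonneg divide_nonneg_nonneg)
    define h where "h = (\<lambda>n u. indicator (almost_primes k) n * fact_weight n * (indicator {0<..} u * real n powr -(1 + u)))"
    have h: "(\<integral>\<^sup>+u. ennreal (h n u) \<partial>lborel) = ennreal (f n)" for n
    proof (cases "n \<in> almost_primes k")
      case True
      \<comment> \<open>Here \<open>k \<ge> 1\<close> excludes \<open>n = 1\<close>, for which the
        integral would diverge.\<close>
      then have n: "n \<ge> 2" using k by (rule almost_primes_ge_2)
      have "real n powr -(1 + u) = 1 / real n * real n powr -u" for u
        using n powr_add[of "real n" "-1" "-u"] by (simp add: powr_neg_one)
      then have "h n u = fact_weight n / real n * (indicator {0<..} u * real n powr -u)" for u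
        using True by (simp add: h_def)
      then have "(\<integral>\<^sup>+u. ennreal (h n u) \<partial>lborel) =
            (\<integral>\<^sup>+u. ennreal (fact_weight n / real n) * ennreal (indicator {0<..} u * real n powr -u) \<partial>lborel)"
        using ennreal_mult'[of "fact_weight n / real n"] by (simp only: fact_weight_nonneg of_nat_0_le_iff divide_nonneg_nonneg)
      also have "\<dots> = ennreal (fact_weight n / real n) * ennreal (1 / ln (real n))"
        using n powr_nn_integral[of "real n" 0] by (subst nn_integral_cmult) auto
      also have "\<dots> = ennreal (f n)"
        using n True by (simp add: f_def fact_weight_nonneg flip: ennreal_mult)
      finally show ?thesis .
    qed (simp add: h_def f_def)
    have "J k = (\<integral>\<^sup>+u. (\<Sum>n. ennreal (h n u)) \<partial>lborel)"
      unfolding J_def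
    proof (rule nn_integral_cong)
      fix u :: real
      show "ennreal (indicator {0<..} u * (prime_zeta (1 + u) ^ k / fact k)) = (\<Sum>n. ennreal (h n u))"
      proof (cases "u > 0")
        case True
        have "(\<lambda>n. indicator (almost_primes k) n * (fact_weight n * real n powr -(1 + u))) sums (prime_zeta (1 + u) ^ k / fact k)"
          using True by (intro has_sum_imp_sums_indicator fact_weight_power_has_sum) simp
        then have *: "(\<lambda>n. h n u) sums (prime_zeta (1 + u) ^ k / fact k)"
          using True by (simp add: h_def mult.assoc)
        have "h n u \<ge> 0" for n by (simp add: h_def fact_weight_nonneg)
        from suminf_ennreal_eq[OF this *]
        have "(\<Sum>n. ennreal (h n u)) = ennreal (prime_zeta (1 + u) ^ k / fact k)" .
        with True show ?thesis by (simp only: indicator_simps greaterThan_iff mult_1)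
      qed (simp add: h_def)
    qed
    also have "\<dots> = (\<Sum>n. \<integral>\<^sup>+u. ennreal (h n u) \<partial>lborel)"
      by (rule nn_integral_suminf) (simp add: h_def)
    also have "\<dots> = (\<Sum>n. ennreal (f n))" by (simp add: h)
    finally have eq: "J k = (\<Sum>n. ennreal (f n))" .
    \<comment> \<open>Convergence of the Erdos sum is deduced from finiteness of the
      integral.\<close>
    have "(\<Sum>n. ennreal (f n)) \<noteq> top" using J1[OF k] by (simp add: eq less_top)
    then have sm: "summable f" using f_nonneg by (intro summable_suminf_not_top)
    then have "J k = ennreal (suminf f)"
      unfolding eq using f_nonneg by (intro suminf_ennreal_eq) (auto intro: summable_sums)
    then have "f sums enn2real (J k)" using sm f_nonneg by (simp add: suminf_nonneg summable_sums)
    then have "(f has_sum enn2real (J k)) UNIV" using f_nonneg by (intro sums_nonneg_imp_has_sum)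
    then show ?thesis
      by (rule has_sum_cong_neutral[THEN iffD1, rotated -1]) (simp_all add: f_def)
  qed
  show "(\<lambda>n. fact_weight n / (real n * ln (real n))) summable_on almost_primes k" if "k \<ge> 1" for k
    using T[OF that] by (rule has_sum_imp_summable)
  have "eventually (\<lambda>k. enn2real (J k) = T k) sequentially"
    using eventually_ge_at_top[of 1] by eventually_elim (simp add: T_def infsumI[OF T])
  with J2 show "T \<longlonglongrightarrow> exp C" by (rule Lim_transform_eventually)
qed

section \<open>The zeta function near 1\<close>

lemma has_sum_greaterThan_0_iff_Suc:
  "((f has_sum S) {0<..}) \<longleftrightarrow> ((\<lambda>n. f (Suc n)) has_sum S) UNIV"
  by (rule has_sum_reindex_bij_witness[where j = "\<lambda>n. n - 1" and i = Suc]) auto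

text \<open>Tannery's theorem, carried over from series indexed from 0 to unordered sums over the
  positive integers.\<close>

lemma tendsto_infsum_dominated:
  fixes a :: "nat \<Rightarrow> 'b \<Rightarrow> real"
  assumes lim: "\<And>d. d > 0 \<Longrightarrow> ((\<lambda>x. a d x) \<longlongrightarrow> b d) F"
    and bound: "eventually (\<lambda>x. \<forall>d>0. \<bar>a d x\<bar> \<le> M d) F"
    and M: "M summable_on {0<..}" and F: "F \<noteq> bot"
  shows "((\<lambda>x. \<Sum>\<^sub>\<infinity>d\<in>{0<..}. a d x) \<longlongrightarrow> (\<Sum>\<^sub>\<infinity>d\<in>{0<..}. b d)) F"
proof -
  have infsum_eq: "(\<Sum>\<^sub>\<infinity>d\<in>{0<..}. g d) = (\<Sum>d. g (Suc d))" if "\<And>d. d > 0 \<Longrightarrow> \<bar>g d\<bar> \<le> M d" for g :: "nat \<Rightarrow> real"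
  proof -
    have "(\<lambda>d. \<bar>g d\<bar>) summable_on {0<..}"
      by (rule summable_on_comparison_test[OF M]) (use that in auto)
    then have "g summable_on {0<..}" by (subst summable_on_iff_abs_summable_on_real) simp
    then have "(g has_sum (\<Sum>\<^sub>\<infinity>d\<in>{0<..}. g d)) {0<..}" by (rule has_sum_infsum)
    then have "(\<lambda>d. g (Suc d)) sums (\<Sum>\<^sub>\<infinity>d\<in>{0<..}. g d)"
      unfolding has_sum_greaterThan_0_iff_Suc by (rule has_sum_imp_sums)
    then show ?thesis by (simp add: sums_iff)
  qed
  \<comment> \<open>The limits inherit the majorant, so their sum is a convergent series
    too.\<close>
  have b: "\<bar>b d\<bar> \<le> M d" if "d > 0" for d
  proof (rule tendsto_upperbound[OF _ _ F])
    show "((\<lambda>x. \<bar>a d x\<bar>) \<longlongrightarrow> \<bar>b d\<bar>) F" by (intro tendsto_rabs lim that)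
    show "eventually (\<lambda>x. \<bar>a d x\<bar> \<le> M d) F" using bound by eventually_elim (use that in auto)
  qed
  have "summable (\<lambda>d. M (Suc d))"
    using M unfolding summable_on_def has_sum_greaterThan_0_iff_Suc
    by (auto dest!: has_sum_imp_sums simp: sums_iff)
  moreover have "eventually (\<lambda>(d,x). norm (a (Suc d) x) \<le> M (Suc d)) (at_top \<times>\<^sub>F F)"
    unfolding eventually_prod_filter
    by (intro exI[of _ "\<lambda>_. True"] exI[of _ "\<lambda>x. \<forall>d>0. \<bar>a d x\<bar> \<le> M d"]) (use bound in auto)
  ultimately have "((\<lambda>x. \<Sum>d. a (Suc d) x) \<longlongrightarrow> (\<Sum>d. b (Suc d))) F"
    using tannerys_theorem[of "\<lambda>d. a (Suc d)" "\<lambda>d. b (Suc d)" F "\<lambda>d. M (Suc d)"] lim F by simp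
  moreover have "eventually (\<lambda>x. (\<Sum>d. a (Suc d) x) = (\<Sum>\<^sub>\<infinity>d\<in>{0<..}. a d x)) F"
    using bound by eventually_elim (rule infsum_eq[symmetric], simp)
  ultimately show ?thesis
    using infsum_eq[of b] b by (simp add: tendsto_cong)
qed

definition zeta_sum :: "real \<Rightarrow> real" where
  "zeta_sum s = (\<Sum>\<^sub>\<infinity>n\<in>{0<..}. real n powr -s)"

lemma zeta_sum_has_sum: "s > 1 \<Longrightarrow> ((\<lambda>n. real n powr -s) has_sum zeta_sum s) {0<..}"
  unfolding zeta_sum_def by (rule has_sum_infsum) (rule summable_on_powr)

text \<open>Mean value theorem for the power \<open>-u\<close> on the interval from \<open>x\<close>
  to \<open>x + 1\<close>. It compares the terms of the zeta series with a telescoping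
  series.\<close>

lemma powr_diff_bounds:
  fixes x u :: real
  assumes "x > 0" "u > 0"
  shows "u * (x + 1) powr -(1 + u) \<le> x powr -u - (x + 1) powr -u"
    and "x powr -u - (x + 1) powr -u \<le> u * x powr -(1 + u)"
proof -
  have "\<exists>z>x. z < x + 1 \<and> (x + 1) powr -u - x powr -u = (x + 1 - x) * (-u * z powr (-u - 1))"
    by (rule MVT2) (use assms in \<open>auto intro!: derivative_eq_intros\<close>)
  then obtain z where z: "z > x" "z < x + 1"
    and mvt: "(x + 1) powr -u - x powr -u = (x + 1 - x) * (-u * z powr (-u - 1))" by blast
  have "-u - 1 = -(1 + u)" by simp
  from mvt[unfolded this] have eq: "x powr -u - (x + 1) powr -u = u * z powr -(1 + u)"
    by simp
  have "(x + 1) powr -(1 + u) \<le> z powr -(1 + u)" "z powr -(1 + u) \<le> x powr -(1 + u)"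
    using z assms by (auto intro!: powr_mono2')
  then show "u * (x + 1) powr -(1 + u) \<le> x powr -u - (x + 1) powr -u"
    "x powr -u - (x + 1) powr -u \<le> u * x powr -(1 + u)"
    unfolding eq using assms by (auto intro!: mult_left_mono)
qed

text \<open>Summing the difference bounds over the positive integers telescopes to 1.\<close>

lemma zeta_sum_bounds:
  assumes u: "u > 0"
  shows "1 \<le> u * zeta_sum (1 + u)" "u * zeta_sum (1 + u) \<le> 1 + u"
proof -
  let ?D = "\<lambda>n. real (n + 1) powr -u - real (n + 2) powr -u"
  have "((\<lambda>n. real n powr -u) \<longlongrightarrow> 0) at_top"
    using u by real_asymp
  then have "(\<lambda>n. real (Suc n) powr -u) \<longlonglongrightarrow> 0" by (rule LIMSEQ_Suc)
  then have D: "?D sums 1"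
    using telescope_sums'[of "\<lambda>n. real (Suc n) powr -u" 0] by (simp add: algebra_simps)
  have Z: "(\<lambda>n. real (Suc n) powr -(1 + u)) sums zeta_sum (1 + u)"
    using zeta_sum_has_sum[of "1 + u", unfolded has_sum_greaterThan_0_iff_Suc] u
    by (intro has_sum_imp_sums) simp
  then have Z1: "(\<lambda>n. u * real (Suc n) powr -(1 + u)) sums (u * zeta_sum (1 + u))"
    by (rule sums_mult)
  \<comment> \<open>The upper bound compares with the series from 2 on; the omitted first term is
    \<open>u\<close>, which accounts for \<open>1 + u\<close> in the claim.\<close>
  have Z2: "(\<lambda>n. u * real (Suc (Suc n)) powr -(1 + u)) sums (u * zeta_sum (1 + u) - u)"
    using Z1 by (subst sums_Suc_iff) simp
  show "1 \<le> u * zeta_sum (1 + u)"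
    by (rule sums_le[OF _ D Z1]) (use powr_diff_bounds(2)[of "real (Suc _)" u] u in \<open>auto simp: add_ac\<close>)
  have "u * zeta_sum (1 + u) - u \<le> 1"
    by (rule sums_le[OF _ Z2 D]) (use powr_diff_bounds(1)[of "real (Suc _)" u] u in \<open>auto simp: add_ac\<close>)
  then show "u * zeta_sum (1 + u) \<le> 1 + u" by simp
qed

lemma zeta_sum_pole: "((\<lambda>u. u * zeta_sum (1 + u)) \<longlongrightarrow> 1) (at_right 0)"
proof (rule tendsto_sandwich)
  show "eventually (\<lambda>u. 1 \<le> u * zeta_sum (1 + u)) (at_right 0)"
    "eventually (\<lambda>u. u * zeta_sum (1 + u) \<le> 1 + u) (at_right 0)"
    using eventually_at_right_less[of "0::real"] by (auto elim!: eventually_mono intro: zeta_sum_bounds)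
  have "((\<lambda>u. 1 + u) \<longlongrightarrow> 1 + 0) (at_right (0::real))" by (intro tendsto_intros)
  then show "((\<lambda>u. 1 + u) \<longlongrightarrow> 1) (at_right (0::real))" by simp
qed simp

text \<open>Dominated convergence with majorant \<open>n powr -2\<close>, whose sum is the Basel
  value.\<close>

lemma zeta_sum_at_2: "((\<lambda>u. zeta_sum (2 * (1 + u))) \<longlongrightarrow> pi\<^sup>2 / 6) (at_right 0)"
proof -
  have sm: "((\<lambda>n. real n powr -2) has_sum (pi\<^sup>2 / 6)) {0<..}"
    unfolding has_sum_greaterThan_0_iff_Suc
    using inverse_squares_sums
    by (intro sums_nonneg_imp_has_sum) (simp_all add: powr_minus_divide add_ac)
  have "((\<lambda>u. \<Sum>\<^sub>\<infinity>n\<in>{0<..}. real n powr -(2 * (1 + u))) \<longlongrightarrow> (\<Sum>\<^sub>\<infinity>n\<in>{0<..}. real n powr -2)) (at_right 0)"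
  proof (rule tendsto_infsum_dominated)
    show "(\<lambda>n. real n powr -2) summable_on {0<..}" using sm by (rule has_sum_imp_summable)
    show "eventually (\<lambda>u. \<forall>n>0. \<bar>real n powr -(2 * (1 + u))\<bar> \<le> real n powr -2) (at_right 0)"
      using eventually_at_right_less[of 0] by eventually_elim (auto intro!: powr_mono)
    fix n :: nat assume "n > 0"
    then have "((\<lambda>u. real n powr -(2 * (1 + u))) \<longlongrightarrow> real n powr -(2 * (1 + 0))) (at_right 0)"
      by (intro tendsto_intros) auto
    then show "((\<lambda>u. real n powr -(2 * (1 + u))) \<longlongrightarrow> real n powr -2) (at_right 0)" by simp
  qed simp
  then show ?thesis using sm by (simp add: zeta_sum_def infsumI)
qed

definition squarefree_zeta_sum :: "real \<Rightarrow> real" where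
  "squarefree_zeta_sum s = (\<Sum>\<^sub>\<infinity>n | squarefree n. real n powr -s)"

text \<open>Every positive integer is uniquely \<open>m * t ^ 2\<close> with \<open>m\<close>
  squarefree, so the double series over \<open>(m, t)\<close> is the zeta series.\<close>

lemma zeta_sum_squarefree:
  assumes s: "s > 1"
  shows "zeta_sum s = squarefree_zeta_sum s * zeta_sum (2 * s)"
proof -
  define F where "F = (\<lambda>(m::nat,t::nat). real m powr -s * real t powr -(2 * s))"
  have inner: "((\<lambda>t. F (m, t)) has_sum real m powr -s * zeta_sum (2 * s)) {0<..}" for m
    unfolding F_def prod.case using s by (intro has_sum_cmult_right zeta_sum_has_sum) simp
  have outer: "((\<lambda>m. real m powr -s * zeta_sum (2 * s)) has_sum squarefree_zeta_sum s * zeta_sum (2 * s)) {m. squarefree m}"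
    unfolding squarefree_zeta_sum_def
    by (intro has_sum_cmult_left has_sum_infsum summable_on_powr s)
  have "F summable_on (SIGMA m:{m. squarefree m}. {0<..})"
    by (rule summable_on_SigmaI[OF inner has_sum_imp_summable[OF outer]]) (auto simp: F_def)
  with inner outer have "(F has_sum squarefree_zeta_sum s * zeta_sum (2 * s)) (SIGMA m:{m. squarefree m}. {0<..})"
    by (rule has_sum_SigmaI)
  then have "((\<lambda>n. real n powr -s) has_sum squarefree_zeta_sum s * zeta_sum (2 * s)) {0<..}"
  proof (rule has_sum_reindex_bij_witness[where i = "\<lambda>n. (squarefree_part n, square_part n)" and
        j = "\<lambda>(m,t). m * t ^ 2", THEN iffD1, rotated -1])
    fix x assume x: "x \<in> (SIGMA m:{m::nat. squarefree m}. {0::nat<..})"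
    obtain m t where [simp]: "x = (m, t)" by (cases x)
    have m: "squarefree m" "m > 0" and t: "t > 0" using x by (auto intro: Nat.gr0I)
    have mult: "multiplicity p (m * t\<^sup>2) = multiplicity p m + 2 * multiplicity p t" if "prime p" for p
      using that m t by (simp add: prime_elem_multiplicity_mult_distrib prime_elem_multiplicity_power_distrib)
    have m1: "multiplicity p m \<le> 1" if "prime p" for p
      using m that by (simp add: squarefree_factorial_semiring'')
    have m2: "multiplicity p m div 2 = 0" "multiplicity p m mod 2 = multiplicity p m" if "prime p" for p
      using m1[OF that] by auto
    have pos: "squarefree_part (m * t\<^sup>2) > 0" "square_part (m * t\<^sup>2) > 0"
      using m t by (intro Nat.gr0I; simp)+
    \<comment> \<open>Exponents of the product determine both factors: their parities give
      \<open>m\<close> and their halves, rounded down, give \<open>t\<close>.\<close>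
    have "squarefree_part (m * t\<^sup>2) = m"
      by (rule multiplicity_eq_nat)
         (use m m2 pos in \<open>simp_all add: prime_multiplicity_squarefree_part mult\<close>)
    moreover have "square_part (m * t\<^sup>2) = t"
      by (rule multiplicity_eq_nat)
         (use m t m2 pos in \<open>simp_all add: prime_multiplicity_square_part mult\<close>)
    ultimately show "(squarefree_part (case x of (m, t) \<Rightarrow> m * t\<^sup>2), square_part (case x of (m, t) \<Rightarrow> m * t\<^sup>2)) = x"
      by simp
    show "(case x of (m, t) \<Rightarrow> m * t\<^sup>2) \<in> {0<..}" using m t by simp
    have "real t powr -(2 * s) = (real t powr 2) powr -s" by (simp only: powr_powr) simp
    then have "real t powr -(2 * s) = real (t\<^sup>2) powr -s" using t by simp
    then show "real (case x of (m, t) \<Rightarrow> m * t\<^sup>2) powr -s = F x"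
      by (simp add: F_def powr_mult)
  next
    fix n :: nat assume n: "n \<in> {0<..}"
    show "(case (squarefree_part n, square_part n) of (m, t) \<Rightarrow> m * t\<^sup>2) = n"
      using squarefree_decompose[of n] by simp
    show "(squarefree_part n, square_part n) \<in> (SIGMA m:{m. squarefree m}. {0<..})"
      using n by (auto intro!: Nat.gr0I simp: squarefree_factorial_semiring'' prime_multiplicity_squarefree_part)
  qed simp
  then show ?thesis using zeta_sum_has_sum[OF s] has_sum_unique by blast
qed

section \<open>Convolutions with powerful support\<close>

definition dirichlet_sum :: "(nat \<Rightarrow> real) \<Rightarrow> real \<Rightarrow> real" where
  "dirichlet_sum a s = (\<Sum>\<^sub>\<infinity>n\<in>{0<..}. a n * real n powr -s)"

text \<open>In terms of generating functions in the prime exponent, \<open>c = g * exp\<close>; hence the name.\<close>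
locale exp_quotient =
  fixes g c :: "nat \<Rightarrow> real"
  assumes g_0: "g 0 = 1" and g_1: "g 1 = 0" and g_bound: "\<And>k. \<bar>g k\<bar> \<le> 1"
    and convolution: "\<And>k. (\<Sum>i\<le>k. g i / fact (k - i)) = c k"
begin

abbreviation G :: "nat \<Rightarrow> real" where "G \<equiv> mult_ext g"

lemma G_summable: "(\<lambda>d. \<bar>G d\<bar> / real d) summable_on {0<..}"
  by (rule mult_ext_summable[of g, OF g_1 g_bound])

lemma divisor_sum:
  "n > 0 \<Longrightarrow> (\<Sum>d | d dvd n. G d * fact_weight (n div d)) = mult_ext c n"
  unfolding fact_weight_def using convolution
  by (subst mult_ext_convolution) (simp_all add: g_0)

text \<open>Since \<open>mult_ext c\<close> is the convolution of \<open>G\<close> and the factorial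
  weight, and \<open>(d * m) powr -s\<close> splits, the series is a product. Absolute convergence
  for \<open>G\<close> already holds at \<open>s = 1\<close>.\<close>

lemma dirichlet_sum_factor:
  assumes s: "s > 1"
  shows "dirichlet_sum (mult_ext c) s = dirichlet_sum G s * exp (prime_zeta s)"
proof -
  have "((\<lambda>n. (\<Sum>d | d dvd n. G d * fact_weight (n div d)) * real n powr -s) has_sum
          (\<Sum>\<^sub>\<infinity>d\<in>{0<..}. G d * (real d powr -s * exp (prime_zeta s)))) {0<..}"
  proof (rule dirichlet_has_sum)
    fix d :: nat assume "d > 0"
    have "((\<lambda>m. real d powr -s * (fact_weight m * real m powr -s)) has_sum real d powr -s * exp (prime_zeta s)) {0<..}"
      by (intro has_sum_cmult_right fact_weight_exp_has_sum s)
    then show "((\<lambda>m. fact_weight m * real (d * m) powr -s) has_sum real d powr -s * exp (prime_zeta s)) {0<..}"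
      by (simp add: powr_mult mult_ac)
  next
    show "(\<lambda>d. \<bar>G d\<bar> * (real d powr -s * exp (prime_zeta s))) summable_on {0<..}"
    proof (rule summable_on_comparison_test)
      show "(\<lambda>d. \<bar>G d\<bar> / real d * exp (prime_zeta s)) summable_on {0<..}"
        by (intro summable_on_cmult_left G_summable)
      fix d :: nat assume "d \<in> {0<..}"
      then have "real d powr -s \<le> real d powr -1" using s by (intro powr_mono) auto
      then have "real d powr -s \<le> 1 / real d" by (simp add: powr_neg_one)
      then have "\<bar>G d\<bar> * (real d powr -s * exp (prime_zeta s)) \<le> \<bar>G d\<bar> * (1 / real d * exp (prime_zeta s))"
        by (intro mult_left_mono mult_right_mono) auto
      then show "\<bar>G d\<bar> * (real d powr -s * exp (prime_zeta s)) \<le> \<bar>G d\<bar> / real d * exp (prime_zeta s)" by simp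
    qed simp
  qed (simp_all add: fact_weight_nonneg)
  then have "((\<lambda>n. mult_ext c n * real n powr -s) has_sum
          (\<Sum>\<^sub>\<infinity>d\<in>{0<..}. G d * real d powr -s * exp (prime_zeta s))) {0<..}"
    by (subst (asm) has_sum_cong[where g = "\<lambda>n. mult_ext c n * real n powr -s"])
       (simp_all add: divisor_sum mult.assoc)
  then show ?thesis
    by (simp add: dirichlet_sum_def infsumI infsum_cmult_left')
qed

lemma dirichlet_sum_tendsto:
  "((\<lambda>u. dirichlet_sum G (1 + u)) \<longlongrightarrow> dirichlet_sum G 1) (at_right 0)"
  unfolding dirichlet_sum_def
proof (rule tendsto_infsum_dominated[OF _ _ G_summable])
  fix d :: nat assume "d > 0"
  then have "((\<lambda>u. G d * real d powr -(1 + u)) \<longlongrightarrow> G d * real d powr -(1 + 0)) (at_right 0)"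
    by (intro tendsto_intros) auto
  then show "((\<lambda>u. G d * real d powr -(1 + u)) \<longlongrightarrow> G d * real d powr -1) (at_right 0)" by simp
next
  show "eventually (\<lambda>u. \<forall>d>0. \<bar>G d * real d powr -(1 + u)\<bar> \<le> \<bar>G d\<bar> / real d) (at_right 0)"
    using eventually_at_right_less[of "0::real"]
  proof eventually_elim
    case (elim u)
    have "\<bar>G d * real d powr -(1 + u)\<bar> \<le> \<bar>G d\<bar> / real d" if "d > 0" for d
    proof -
      have "real d powr -(1 + u) \<le> real d powr -1" using that elim by (intro powr_mono) auto
      then have "\<bar>G d\<bar> * real d powr -(1 + u) \<le> \<bar>G d\<bar> * (1 / real d)"
        by (intro mult_left_mono) (auto simp: powr_neg_one)
      then show ?thesis by (simp add: abs_mult)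
    qed
    then show ?case by blast
  qed
qed simp

text \<open>Writing \<open>n = d * m\<close> turns the sum into one over \<open>d\<close> of
  \<open>G d * W k d\<close>, where \<open>W k d\<close> sums over \<open>m\<close> with \<Omega>
  equal to \<open>k - big_omega d\<close>. For fixed \<open>d\<close> the ratio of
  \<open>ln (d * m)\<close> to \<open>ln m\<close> tends to 1 uniformly in these \<open>m\<close>,
  so \<open>W k d\<close> tends to \<open>exp C / d\<close>; the bound \<open>B / d\<close> permits
  dominated convergence.\<close>

lemma erdos_weight_tendsto:
  assumes lim: "((\<lambda>u. prime_zeta (1 + u) + ln u) \<longlongrightarrow> C) (at_right 0)"
  shows "(\<lambda>k. \<Sum>\<^sub>\<infinity>n\<in>almost_primes k. mult_ext c n / (real n * ln (real n)))
           \<longlonglongrightarrow> exp C * dirichlet_sum G 1"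
proof -
  define T where "T = (\<lambda>k. \<Sum>\<^sub>\<infinity>n\<in>almost_primes k. fact_weight n / (real n * ln (real n)))"
  define t where "t = (\<lambda>d m. fact_weight m / (real (d * m) * ln (real (d * m))))"
  \<comment> \<open>If \<open>big_omega d\<close> exceeds \<open>k\<close>, no multiple of
    \<open>d\<close> lies in \<open>almost_primes k\<close>; the case split also guards against
    truncated subtraction.\<close>
  define W where "W = (\<lambda>k d. if big_omega d \<le> k then infsum (t d) (almost_primes (k - big_omega d)) else 0)"
  have T_sum: "((\<lambda>n. fact_weight n / (real n * ln (real n))) has_sum T k) (almost_primes k)" if "k \<ge> 1" for k
    unfolding T_def using fact_weight_erdos_sums(1)[OF lim that] by (rule has_sum_infsum)
  have T_lim: "T \<longlonglongrightarrow> exp C" unfolding T_def by (rule fact_weight_erdos_sums(2)[OF lim])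
  have "Bseq T" using T_lim by (intro convergent_imp_Bseq convergentI)
  then obtain B0 where B0: "\<And>k. \<bar>T k\<bar> \<le> B0" unfolding Bseq_def real_norm_def by blast
  \<comment> \<open>The 2 covers the case \<open>big_omega d = k\<close>: then \<open>m = 1\<close>
    is the only cofactor and \<open>1 / ln d \<le> 1 / ln 2 \<le> 2\<close>.\<close>
  define B where "B = max B0 2"
  have t_bounds: "0 \<le> t d m" "t d m \<le> 1 / real d * (fact_weight m / (real m * ln (real m)))"
    "real j * ln 2 / (real j * ln 2 + ln (real d)) * (1 / real d * (fact_weight m / (real m * ln (real m)))) \<le> t d m"
    if d: "d > 0" and m: "m \<in> almost_primes j" and j: "j \<ge> 1" for d m j
  proof -
    have m2: "m \<ge> 2" using m j by (rule almost_primes_ge_2)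
    have "real (2 ^ j) \<le> real m"
      using two_power_big_omega_le[of m] m m2 by (simp add: almost_primes_def del: of_nat_power)
    then have "ln (2 ^ j) \<le> ln (real m)" by (intro ln_mono) auto
    then have L: "real j * ln 2 \<le> ln (real m)" by (simp add: ln_realpow)
    have pos: "ln (real m) > 0" "ln (real d) \<ge> 0" "real j * ln 2 > 0" "real m > 0" "real d > 0"
      using m2 d j by auto
    have tdm: "t d m = 1 / real d * (fact_weight m / real m) * (1 / (ln (real m) + ln (real d)))"
      using pos by (simp add: t_def ln_mult field_simps)
    show "0 \<le> t d m" unfolding tdm using pos by (simp add: fact_weight_nonneg)
    have "1 / (ln (real m) + ln (real d)) \<le> 1 / ln (real m)"
      using pos by (intro frac_le) auto
    then have "t d m \<le> 1 / real d * (fact_weight m / real m) * (1 / ln (real m))"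
      unfolding tdm using pos by (intro mult_left_mono) (auto simp: fact_weight_nonneg)
    then show "t d m \<le> 1 / real d * (fact_weight m / (real m * ln (real m)))" by simp
    have "real j * ln 2 * ln (real d) \<le> ln (real m) * ln (real d)"
      using L pos by (intro mult_right_mono) auto
    \<comment> \<open>The quotient \<open>x / (x + ln d)\<close> increases with \<open>x\<close>,
      and \<open>ln m\<close> is at least \<open>j * ln 2\<close>; this yields a lower factor that
      no longer depends on \<open>m\<close>.\<close>
    then have "real j * ln 2 / (real j * ln 2 + ln (real d)) \<le> ln (real m) / (ln (real m) + ln (real d))"
      using pos by (simp add: divide_simps add_pos_nonneg) (simp add: algebra_simps)
    then have "real j * ln 2 / (real j * ln 2 + ln (real d)) * (1 / real d * (fact_weight m / (real m * ln (real m)))) \<le>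
       ln (real m) / (ln (real m) + ln (real d)) * (1 / real d * (fact_weight m / (real m * ln (real m))))"
      using pos by (intro mult_right_mono) (auto simp: fact_weight_nonneg)
    also have "\<dots> = t d m" unfolding tdm using pos by simp
    finally show "real j * ln 2 / (real j * ln 2 + ln (real d)) * (1 / real d * (fact_weight m / (real m * ln (real m)))) \<le> t d m" .
  qed
  have t_sum: "t d summable_on almost_primes j" "infsum (t d) (almost_primes j) \<le> 1 / real d * T j"
    "real j * ln 2 / (real j * ln 2 + ln (real d)) * (1 / real d * T j) \<le> infsum (t d) (almost_primes j)"
    "0 \<le> infsum (t d) (almost_primes j)"
    if d: "d > 0" and j: "j \<ge> 1" for d j
  proof -
    have s: "((\<lambda>m. 1 / real d * (fact_weight m / (real m * ln (real m)))) has_sum 1 / real d * T j) (almost_primes j)"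
      by (intro has_sum_cmult_right T_sum j)
    then have s': "((\<lambda>m. real j * ln 2 / (real j * ln 2 + ln (real d)) * (1 / real d * (fact_weight m / (real m * ln (real m)))))
        has_sum real j * ln 2 / (real j * ln 2 + ln (real d)) * (1 / real d * T j)) (almost_primes j)"
      by (rule has_sum_cmult_right)
    show sm: "t d summable_on almost_primes j"
      by (rule summable_on_comparison_test[OF has_sum_imp_summable[OF s]]) (use t_bounds[OF d _ j] in auto)
    show "infsum (t d) (almost_primes j) \<le> 1 / real d * T j"
      by (rule has_sum_mono[OF has_sum_infsum[OF sm] s]) (use t_bounds[OF d _ j] in auto)
    show "real j * ln 2 / (real j * ln 2 + ln (real d)) * (1 / real d * T j) \<le> infsum (t d) (almost_primes j)"
      by (rule has_sum_mono[OF s' has_sum_infsum[OF sm]]) (use t_bounds[OF d _ j] in auto)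
    show "0 \<le> infsum (t d) (almost_primes j)"
      by (rule infsum_nonneg) (use t_bounds[OF d _ j] in auto)
  qed
  have t_sum_0: "infsum (t d) (almost_primes 0) = 1 / (real d * ln (real d))" "t d summable_on almost_primes 0" for d
    by (simp_all add: almost_primes_0 t_def)
  have W_bounds: "0 \<le> W k d" "W k d \<le> B / real d" if d: "d > 0" and k: "k \<ge> 1" for k d
  proof -
    consider "big_omega d > k" | "big_omega d = k" | "big_omega d < k" by linarith
    then have "0 \<le> W k d \<and> W k d \<le> B / real d"
    proof cases
      case 1
      then show ?thesis by (simp add: W_def B_def)
    next
      case 2
      then have "d \<ge> 2" using d k almost_primes_ge_2[of d k] by (simp add: almost_primes_def)
      then have "ln (real d) \<ge> ln 2" by (intro ln_mono) auto
      moreover have "ln 2 \<ge> (1 / 2 :: real)" using ln2_ge_two_thirds by simp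
      ultimately have "1 / ln (real d) \<le> 2" by (simp add: divide_simps)
      then have "1 / ln (real d) \<le> B" by (simp add: B_def)
      then have "1 / ln (real d) / real d \<le> B / real d" by (intro divide_right_mono) auto
      with \<open>d \<ge> 2\<close> 2 t_sum_0(1)[of d] show ?thesis by (simp add: W_def mult.commute)
    next
      case 3
      then have j: "k - big_omega d \<ge> 1" by simp
      have "1 / real d * T (k - big_omega d) \<le> 1 / real d * B"
        using B0[of "k - big_omega d"] by (intro mult_left_mono) (auto simp: B_def)
      then show ?thesis using 3 t_sum(2,4)[OF d j] by (simp add: W_def)
    qed
    then show "0 \<le> W k d" "W k d \<le> B / real d" by auto
  qed
  have main_sum: "((\<lambda>n. mult_ext c n / (real n * ln (real n))) has_sum (\<Sum>\<^sub>\<infinity>d\<in>{0<..}. G d * W k d)) (almost_primes k)"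
    if k: "k \<ge> 1" for k
  proof -
    define \<phi> where "\<phi> = (\<lambda>n. indicator (almost_primes k) n * (1 / (real n * ln (real n))))"
    have "((\<lambda>n. (\<Sum>d | d dvd n. G d * fact_weight (n div d)) * \<phi> n) has_sum (\<Sum>\<^sub>\<infinity>d\<in>{0<..}. G d * W k d)) {0<..}"
    proof (rule dirichlet_has_sum)
      show "\<phi> n \<ge> 0" for n
        by (cases "n = 0") (auto simp: \<phi>_def indicator_def)
      fix d :: nat assume d: "d > 0"
      show "((\<lambda>m. fact_weight m * \<phi> (d * m)) has_sum W k d) {0<..}"
      proof (cases "big_omega d \<le> k")
        case True
        then have "t d summable_on almost_primes (k - big_omega d)"
          using t_sum(1)[OF d, of "k - big_omega d"] t_sum_0(2)[of d] by (cases "big_omega d = k") auto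
        then have "(t d has_sum W k d) (almost_primes (k - big_omega d))"
          using True by (simp add: W_def)
        then show ?thesis
          by (rule has_sum_cong_neutral[THEN iffD1, rotated -1])
             (use d True in \<open>auto simp: t_def \<phi>_def almost_primes_def big_omega_mult indicator_def\<close>)
      next
        case False
        have "((\<lambda>m. fact_weight m * \<phi> (d * m)) has_sum 0) {0<..}"
          by (rule has_sum_0) (use d False in \<open>auto simp: \<phi>_def almost_primes_def big_omega_mult indicator_def\<close>)
        then show ?thesis using False by (simp add: W_def)
      qed
    next
      show "(\<lambda>d. \<bar>G d\<bar> * W k d) summable_on {0<..}"
      proof (rule summable_on_comparison_test)
        show "(\<lambda>d. \<bar>G d\<bar> / real d * B) summable_on {0<..}"
          by (intro summable_on_cmult_left G_summable)
        fix d :: nat assume "d \<in> {0<..}"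
        then have "\<bar>G d\<bar> * W k d \<le> \<bar>G d\<bar> * (B / real d)"
          using W_bounds[of d k] k by (intro mult_left_mono) auto
        then show "\<bar>G d\<bar> * W k d \<le> \<bar>G d\<bar> / real d * B" by simp
        show "0 \<le> \<bar>G d\<bar> * W k d" using W_bounds[of d k] k \<open>d \<in> _\<close> by simp
      qed
    qed (rule fact_weight_nonneg)
    then show ?thesis
      by (rule has_sum_cong_neutral[THEN iffD1, rotated -1])
         (auto simp: \<phi>_def divisor_sum almost_primes_pos)
  qed
  have W_lim: "(\<lambda>k. W k d) \<longlonglongrightarrow> exp C / real d" if d: "d > 0" for d
  \<comment> \<open>Replacing \<open>k\<close> by \<open>j + big_omega d\<close> makes the inner sum
    run over \<open>almost_primes j\<close>.\<close>
  proof (rule LIMSEQ_offset)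
    let ?L = "\<lambda>j. real j * ln 2 / (real j * ln 2 + ln (real d)) * (1 / real d * T j)"
    let ?a = "big_omega d"
    have "(\<lambda>j. real j * ln 2 / (real j * ln 2 + ln (real d))) \<longlonglongrightarrow> 1" by real_asymp
    then have "?L \<longlonglongrightarrow> 1 * (1 / real d * exp C)"
      by (intro tendsto_mult T_lim tendsto_const)
    then have L: "?L \<longlonglongrightarrow> exp C / real d" by simp
    have "(\<lambda>j. 1 / real d * T j) \<longlonglongrightarrow> 1 / real d * exp C"
      by (intro tendsto_mult T_lim tendsto_const)
    then have U: "(\<lambda>j. 1 / real d * T j) \<longlonglongrightarrow> exp C / real d" by simp
    have "eventually (\<lambda>j. ?L j \<le> W (j + ?a) d) sequentially"
      using eventually_ge_at_top[of 1] by eventually_elim (use t_sum(3)[OF d] in \<open>simp add: W_def\<close>)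
    moreover have "eventually (\<lambda>j. W (j + ?a) d \<le> 1 / real d * T j) sequentially"
      using eventually_ge_at_top[of 1] by eventually_elim (use t_sum(2)[OF d] in \<open>simp add: W_def\<close>)
    ultimately show "(\<lambda>j. W (j + ?a) d) \<longlonglongrightarrow> exp C / real d"
      using L U by (rule tendsto_sandwich)
  qed
  have "(\<lambda>k. \<Sum>\<^sub>\<infinity>d\<in>{0<..}. G d * W k d) \<longlonglongrightarrow> (\<Sum>\<^sub>\<infinity>d\<in>{0<..}. G d * (exp C / real d))"
  proof (rule tendsto_infsum_dominated)
    show "(\<lambda>k. G d * W k d) \<longlonglongrightarrow> G d * (exp C / real d)" if "d > 0" for d
      by (intro tendsto_mult tendsto_const W_lim that)
    show "(\<lambda>d. \<bar>G d\<bar> / real d * B) summable_on {0<..}"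
      by (intro summable_on_cmult_left G_summable)
    show "eventually (\<lambda>k. \<forall>d>0. \<bar>G d * W k d\<bar> \<le> \<bar>G d\<bar> / real d * B) sequentially"
      using eventually_ge_at_top[of 1]
    proof eventually_elim
      case (elim k)
      have "\<bar>G d * W k d\<bar> \<le> \<bar>G d\<bar> / real d * B" if "d > 0" for d
      proof -
        have "\<bar>G d\<bar> * W k d \<le> \<bar>G d\<bar> * (B / real d)"
          using W_bounds[OF that elim] by (intro mult_left_mono) auto
        then show ?thesis using W_bounds[OF that elim] by (simp add: abs_mult)
      qed
      then show ?case by blast
    qed
  qed simp
  also have "(\<Sum>\<^sub>\<infinity>d\<in>{0<..}. G d * (exp C / real d)) = (\<Sum>\<^sub>\<infinity>d\<in>{0<..}. exp C * (G d * real d powr -1))"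
    by (rule infsum_cong) (simp add: powr_neg_one)
  also have "\<dots> = exp C * dirichlet_sum G 1"
    unfolding dirichlet_sum_def by (rule infsum_cmult_right')
  finally show ?thesis
    by (rule Lim_transform_eventually)
       (use eventually_ge_at_top[of 1] in \<open>eventually_elim, simp add: infsumI[OF main_sum]\<close>)
qed

end

section \<open>The limits\<close>

text \<open>The coefficients of \<open>exp (-x)\<close> times the generating function of
  \<open>c\<close>, that is, of the quotient by \<open>exp x\<close> which the locale asks
  for.\<close>

definition exp_quotient_coeff :: "(nat \<Rightarrow> real) \<Rightarrow> nat \<Rightarrow> real" where
  "exp_quotient_coeff c k = (\<Sum>i\<le>k. (-1) ^ i / fact i * c (k - i))"

lemma exp_quotient_coeff_convolution:
  "(\<Sum>i\<le>k. exp_quotient_coeff c i / fact (k - i)) = c k"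
proof -
  have "Abs_fps (exp_quotient_coeff c) = fps_exp (-1) * Abs_fps c"
    by (rule fps_ext) (simp add: exp_quotient_coeff_def fps_mult_nth atLeast0AtMost)
  then have "Abs_fps (exp_quotient_coeff c) * fps_exp 1 = fps_exp (-1) * fps_exp 1 * Abs_fps c"
    by (simp add: mult_ac)
  also have "fps_exp (-1) * fps_exp 1 = (1 :: real fps)"
    using fps_exp_add_mult[of "-1" "1::real"] by simp
  finally have "fps_nth (Abs_fps (exp_quotient_coeff c) * fps_exp 1) k = fps_nth (Abs_fps c) k"
    by simp
  then show ?thesis by (simp add: fps_mult_nth atLeast0AtMost)
qed

text \<open>These are the partial sums of the alternating series for \<open>exp (-1)\<close>, whose
  terms decrease in absolute value; the even ones stay below the initial value 1 and the odd ones
  above the value 0 at \<open>k = 1\<close>.\<close>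

lemma exp_quotient_coeff_1_bounds:
  "0 \<le> exp_quotient_coeff (\<lambda>_. 1) k" "exp_quotient_coeff (\<lambda>_. 1) k \<le> 1"
proof -
  let ?h = "exp_quotient_coeff (\<lambda>_. 1)"
  have step: "?h (Suc k) = ?h k + (-1) ^ Suc k / fact (Suc k)" for k
    by (simp add: exp_quotient_coeff_def)
  have le: "1 / fact (Suc k) \<le> (1 / fact k :: real)" for k
    by (intro divide_left_mono fact_mono) auto
  have *: "0 \<le> ?h (Suc (2 * m)) \<and> ?h (Suc (2 * m)) \<le> ?h (2 * m) \<and> ?h (2 * m) \<le> 1" for m
  proof (induction m)
    case 0
    show ?case by (simp add: exp_quotient_coeff_def)
  next
    case (Suc m)
    have h1: "?h (2 * Suc m) = ?h (Suc (2 * m)) + 1 / fact (Suc (Suc (2 * m)))"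
      using step[of "Suc (2 * m)"] by simp
    have h2: "?h (Suc (2 * Suc m)) = ?h (2 * Suc m) - 1 / fact (Suc (Suc (Suc (2 * m))))"
      using step[of "2 * Suc m"] by simp
    have h3: "?h (Suc (2 * m)) = ?h (2 * m) - 1 / fact (Suc (2 * m))"
      using step[of "2 * m"] by simp
    have "0 \<le> (1 / fact (Suc (Suc (Suc (2 * m)))) :: real)" by simp
    with Suc.IH h1 h2 h3 le[of "Suc (2 * m)"] le[of "Suc (Suc (2 * m))"] show ?case by linarith
  qed
  have "k = 2 * (k div 2) \<or> k = Suc (2 * (k div 2))" by presburger
  then show "0 \<le> ?h k" "?h k \<le> 1"
    using *[of "k div 2"] by (metis order.trans)+
qed

text \<open>Multiplying \<open>1 + x\<close> by \<open>exp (-x)\<close> leaves only two terms in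
  each coefficient after the first.\<close>

lemma exp_quotient_coeff_squarefree_Suc:
  "exp_quotient_coeff squarefree_coeff (Suc k) = (-1) ^ k * (1 / fact k - 1 / fact (Suc k))"
proof -
  have "(\<Sum>i<k. (-1) ^ i / fact i * squarefree_coeff (Suc k - i)) = 0"
    by (intro sum.neutral) (auto simp: squarefree_coeff_def)
  then show ?thesis
    by (simp add: exp_quotient_coeff_def squarefree_coeff_def lessThan_Suc_atMost[symmetric] diff_divide_distrib algebra_simps del: fact_Suc)
qed

text \<open>The coefficient of index 1 is \<open>c 1 - c 0\<close>, which is 0 here and in the
  squarefree case alike. Hence both functions \<open>G\<close> live on powerful numbers.\<close>

interpretation full: exp_quotient "exp_quotient_coeff (\<lambda>_. 1)" "\<lambda>_. 1"
  using exp_quotient_coeff_1_bounds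
  by unfold_locales (auto simp: exp_quotient_coeff_convolution abs_le_iff
      intro: order_trans[of "- _" 0] exp_quotient_coeff_def[THEN trans])

interpretation sqf: exp_quotient "exp_quotient_coeff squarefree_coeff" squarefree_coeff
proof
  fix k
  show "\<bar>exp_quotient_coeff squarefree_coeff k\<bar> \<le> 1"
  proof (cases k)
    case (Suc j)
    define x y :: real where "x = 1 / fact j" and "y = 1 / fact (Suc j)"
    have "0 \<le> y" "y \<le> x" "x \<le> 1"
      unfolding x_def y_def by (simp_all add: frac_le fact_mono fact_ge_1 del: fact_Suc)
    then have "\<bar>(-1) ^ j * (x - y)\<bar> \<le> 1" by (simp add: abs_mult)
    then show ?thesis
      unfolding Suc exp_quotient_coeff_squarefree_Suc x_def y_def .
  qed (simp add: exp_quotient_coeff_def squarefree_coeff_def)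
qed (rule exp_quotient_coeff_convolution | simp add: exp_quotient_coeff_def squarefree_coeff_def)+

lemma dirichlet_sum_1: "dirichlet_sum (mult_ext (\<lambda>_. 1)) s = zeta_sum s"
  by (simp add: dirichlet_sum_def zeta_sum_def)

lemma dirichlet_sum_squarefree: "dirichlet_sum (mult_ext squarefree_coeff) s = squarefree_zeta_sum s"
  unfolding dirichlet_sum_def squarefree_zeta_sum_def
  by (rule infsum_cong_neutral) (auto simp: mult_ext_squarefree intro: Nat.gr0I)

text \<open>All terms are nonnegative and the term at 1 equals 1. Positivity is what permits
  dividing by this constant and taking its logarithm.\<close>

lemma full_dirichlet_sum_pos: "dirichlet_sum full.G 1 > 0"
proof -
  have nonneg: "full.G n \<ge> 0" for n
    by (rule mult_ext_nonneg) (rule exp_quotient_coeff_1_bounds)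
  have "(\<lambda>n. full.G n * real n powr -1) summable_on {0<..}"
    using full.G_summable by (simp add: nonneg powr_neg_one)
  then have "(\<Sum>n\<in>{1}. full.G n * real n powr -1) \<le> dirichlet_sum full.G 1"
    unfolding dirichlet_sum_def by (rule finite_sum_le_infsum) (auto simp: nonneg)
  then show ?thesis by (simp add: mult_ext_def)
qed

text \<open>Take logarithms in the factorization of the zeta function, after multiplying by
  \<open>u\<close> to remove the pole at 1.\<close>

lemma prime_zeta_asymp:
  "((\<lambda>u. prime_zeta (1 + u) + ln u) \<longlongrightarrow> ln (1 / dirichlet_sum full.G 1)) (at_right 0)"
proof -
  have "((\<lambda>u. u * zeta_sum (1 + u) / dirichlet_sum full.G (1 + u)) \<longlongrightarrow> 1 / dirichlet_sum full.G 1) (at_right 0)"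
    using full_dirichlet_sum_pos by (intro tendsto_divide zeta_sum_pole full.dirichlet_sum_tendsto) auto
  then have "((\<lambda>u. ln (u * zeta_sum (1 + u) / dirichlet_sum full.G (1 + u))) \<longlongrightarrow> ln (1 / dirichlet_sum full.G 1)) (at_right 0)"
    using full_dirichlet_sum_pos by (intro tendsto_ln) auto
  moreover have "eventually (\<lambda>u. dirichlet_sum full.G (1 + u) > 0) (at_right 0)"
    using full.dirichlet_sum_tendsto full_dirichlet_sum_pos by (rule order_tendstoD)
  then have "eventually (\<lambda>u. ln (u * zeta_sum (1 + u) / dirichlet_sum full.G (1 + u)) = prime_zeta (1 + u) + ln u) (at_right 0)"
    using eventually_at_right_less[of "0::real"]
  proof eventually_elim
    case (elim u)
    have "zeta_sum (1 + u) = dirichlet_sum full.G (1 + u) * exp (prime_zeta (1 + u))"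
      using full.dirichlet_sum_factor[of "1 + u"] elim by (simp add: dirichlet_sum_1)
    with elim show ?case by (simp add: ln_mult)
  qed
  ultimately show ?thesis by (rule Lim_transform_eventually)
qed

text \<open>The zeta function at \<open>s\<close> is the squarefree series at \<open>s\<close> times
  the zeta function at \<open>2 * s\<close>. Both series at \<open>s\<close> carry the same factor
  \<open>exp (prime_zeta s)\<close>, which cancels; then let \<open>s\<close> tend to 1.\<close>

lemma dirichlet_sum_squarefree_eq: "dirichlet_sum sqf.G 1 * (pi\<^sup>2 / 6) = dirichlet_sum full.G 1"
proof (rule tendsto_unique)
  show "((\<lambda>u. dirichlet_sum sqf.G (1 + u) * zeta_sum (2 * (1 + u))) \<longlongrightarrow> dirichlet_sum sqf.G 1 * (pi\<^sup>2 / 6)) (at_right 0)"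
    by (intro tendsto_mult sqf.dirichlet_sum_tendsto zeta_sum_at_2)
  have "eventually (\<lambda>u. dirichlet_sum full.G (1 + u) = dirichlet_sum sqf.G (1 + u) * zeta_sum (2 * (1 + u))) (at_right 0)"
    using eventually_at_right_less[of "0::real"]
  proof eventually_elim
    case (elim u)
    have "dirichlet_sum full.G (1 + u) * exp (prime_zeta (1 + u)) =
          dirichlet_sum sqf.G (1 + u) * exp (prime_zeta (1 + u)) * zeta_sum (2 * (1 + u))"
      using full.dirichlet_sum_factor[of "1 + u"] sqf.dirichlet_sum_factor[of "1 + u"]
        zeta_sum_squarefree[of "1 + u"] elim
      by (simp add: dirichlet_sum_1 dirichlet_sum_squarefree)
    then show ?case by simp
  qed
  with full.dirichlet_sum_tendsto
  show "((\<lambda>u. dirichlet_sum sqf.G (1 + u) * zeta_sum (2 * (1 + u))) \<longlongrightarrow> dirichlet_sum full.G 1) (at_right 0)"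
    by (rule Lim_transform_eventually)
qed simp

theorem theorem2p2:
  shows "(\<forall>k\<ge>1. erdos_sum (almost_primes k) =
            (\<Sum>\<^sub>\<infinity>n\<in>{n. n \<ge> 1 \<and> big_omega n = k}. 1 / (real n * ln (real n))))
       \<and> (\<lambda>k. erdos_sum (almost_primes k)) \<sim>[at_top] (\<lambda>k. 1)
       \<and> (\<forall>k\<ge>1. erdos_sum (squarefree_almost_primes k) =
            (\<Sum>\<^sub>\<infinity>n\<in>{n. n \<ge> 1 \<and> big_omega n = k}.
               (real_of_int (moebius_mu n))\<^sup>2 / (real n * ln (real n))))
       \<and> (\<lambda>k. erdos_sum (squarefree_almost_primes k)) \<sim>[at_top] (\<lambda>k. 6 / pi\<^sup>2)"
proof (intro conjI allI impI)
  define S where "S = dirichlet_sum full.G 1"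
  have S: "S > 0" using full_dirichlet_sum_pos by (simp add: S_def)
  \<comment> \<open>The constant of the prime zeta asymptotics is \<open>ln (1 / S)\<close>, so in
    the unrestricted case the limit \<open>exp C * S\<close> is 1.\<close>
  have C: "exp (ln (1 / S)) = 1 / S" using S by simp
  show "erdos_sum (almost_primes k) =
            (\<Sum>\<^sub>\<infinity>n\<in>{n. n \<ge> 1 \<and> big_omega n = k}. 1 / (real n * ln (real n)))" for k
    by (simp add: erdos_sum_def almost_primes_def)
  show "erdos_sum (squarefree_almost_primes k) =
            (\<Sum>\<^sub>\<infinity>n\<in>{n. n \<ge> 1 \<and> big_omega n = k}.
               (real_of_int (moebius_mu n))\<^sup>2 / (real n * ln (real n)))" for k
    unfolding erdos_sum_def
    by (rule infsum_cong_neutral)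
       (auto simp: squarefree_almost_primes_def almost_primes_def moebius_mu_def power_mult[symmetric])
  have "(\<lambda>k. erdos_sum (almost_primes k)) \<longlonglongrightarrow> 1"
    using full.erdos_weight_tendsto[OF prime_zeta_asymp] S
    by (simp add: erdos_sum_def C flip: S_def)
  then show "(\<lambda>k. erdos_sum (almost_primes k)) \<sim>[at_top] (\<lambda>k. 1)"
    by (rule tendsto_imp_asymp_equiv_const) simp
  have "erdos_sum (squarefree_almost_primes k) =
        (\<Sum>\<^sub>\<infinity>n\<in>almost_primes k. mult_ext squarefree_coeff n / (real n * ln (real n)))" for k
    unfolding erdos_sum_def
    by (rule infsum_cong_neutral)
       (auto simp: squarefree_almost_primes_def mult_ext_squarefree almost_primes_pos)
  then have "(\<lambda>k. erdos_sum (squarefree_almost_primes k)) \<longlonglongrightarrow> 1 / S * dirichlet_sum sqf.G 1"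
    using sqf.erdos_weight_tendsto[OF prime_zeta_asymp] by (simp only: C flip: S_def)
  \<comment> \<open>Here \<open>S\<close> cancels because it is \<open>pi\<^sup>2 / 6\<close> times
    the squarefree constant.\<close>
  also have "1 / S * dirichlet_sum sqf.G 1 = 6 / pi\<^sup>2"
    using dirichlet_sum_squarefree_eq S by (simp add: S_def field_simps)
  finally show "(\<lambda>k. erdos_sum (squarefree_almost_primes k)) \<sim>[at_top] (\<lambda>k. 6 / pi\<^sup>2)"
    by (rule tendsto_imp_asymp_equiv_const) simp
qed

end
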